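(* There is an algorithm which, given a positive integer $n$, computes both the number $|\mathcal{C}_n|$ of permutations of $\{1,\dots,n\}$ sortable on two parallel stacks and the number $|\mathcal{D}_n|$ of permutations of $\{1,\dots,n\}$ sortable on a deque, using $O(n^5 2^n)$ time and $O(n^2 2^n)$ space (in the model where integer arithmetic and dictionary lookups take constant time).
   Context: A permutation $\pi$ of $\{1,\dots,n\}$ is fed as an input list $\pi_1\cdots\pi_n$. Sorting on two parallel stacks: allowed operations are moving the first input element onto the top of either of two stacks, and moving the top element of either nonempty stack to the end of the output list; $\pi$ is sortable on two parallel stacks if some sequence of operations ends with output $1,2,\dots,n$. Sorting on a deque: allowed operations are moving the first input element to the left or right end of a deque (double-ended queue), and moving the left or right end element of a nonempty deque to the end of the output; $\pi$ is sortable on a deque if some sequence of operations ends with output $1,2,\dots,n$. $\mathcal{C}_n$ and $\mathcal{D}_n$ denote the sets of such sortable permutations of length $n$. *)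

theory Defs
  imports Complex_Main "HOL-Library.Landau_Symbols" "HOL-Combinatorics.Multiset_Permutations"
begin

section \<open>Sorting on two parallel stacks\<close>

text \<open>
  A configuration is (remaining input, first stack, second stack, output).
  The head of a stack is its top.
\<close>

type_synonym stacks_config = "nat list \<times> nat list \<times> nat list \<times> nat list"

inductive stacks_step :: "stacks_config \<Rightarrow> stacks_config \<Rightarrow> bool" where
  push_first: "stacks_step (x # xs, a, b, out) (xs, x # a, b, out)"
| push_second: "stacks_step (x # xs, a, b, out) (xs, a, x # b, out)"
| pop_first: "stacks_step (xs, y # a, b, out) (xs, a, b, out @ [y])"
| pop_second: "stacks_step (xs, a, y # b, out) (xs, a, b, out @ [y])"

definition stacks_sortable :: "nat list \<Rightarrow> bool" where
  "stacks_sortable p \<longleftrightarrow>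
     stacks_step\<^sup>*\<^sup>* (p, [], [], []) ([], [], [], [1..<Suc (length p)])"

definition stacks_sortable_perms :: "nat \<Rightarrow> nat list set" where
  "stacks_sortable_perms n = {p \<in> permutations_of_set {1..n}. stacks_sortable p}"


section \<open>Sorting on a deque\<close>

text \<open>
  A configuration is (remaining input, deque, output).
  The head of the deque list is its left end, the last element its right end.
\<close>

type_synonym deque_config = "nat list \<times> nat list \<times> nat list"

inductive deque_step :: "deque_config \<Rightarrow> deque_config \<Rightarrow> bool" where
  push_left: "deque_step (x # xs, d, out) (xs, x # d, out)"
| push_right: "deque_step (x # xs, d, out) (xs, d @ [x], out)"
| pop_left: "deque_step (xs, y # d, out) (xs, d, out @ [y])"
| pop_right: "deque_step (xs, d @ [y], out) (xs, d, out @ [y])"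

definition deque_sortable :: "nat list \<Rightarrow> bool" where
  "deque_sortable p \<longleftrightarrow>
     deque_step\<^sup>*\<^sup>* (p, [], []) ([], [], [1..<Suc (length p)])"

definition deque_sortable_perms :: "nat \<Rightarrow> nat list set" where
  "deque_sortable_perms n = {p \<in> permutations_of_set {1..n}. deque_sortable p}"


section \<open>Unit-cost machine with integers and dictionaries\<close>

text \<open>
  Algorithms are programs of a while language over unbounded integers, with integer
  variables and named dictionaries from integers to integers. The whole store is one
  partial map: \<open>Reg x\<close> is the variable \<open>x\<close>, \<open>Cell d k\<close> is the entry with key \<open>k\<close> of the
  dictionary \<open>d\<close>, and locations mapped to \<open>None\<close> are not in use. Composite keys have to be
  encoded by integer arithmetic, and a recursion stack by a dictionary.
\<close>

datatype loc = Reg string | Cell string int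

type_synonym state = "loc \<rightharpoonup> int"

text \<open>Reading a location that is not in use yields 0.\<close>

definition read :: "state \<Rightarrow> loc \<Rightarrow> int" where
  "read s l = (case s l of None \<Rightarrow> 0 | Some v \<Rightarrow> v)"

datatype aexp =
    Const int
  | Var string
  | Plus aexp aexp
  | Minus aexp aexp
  | Times aexp aexp
  | Div aexp aexp
  | Mod aexp aexp
  | Lookup string aexp

datatype bexp =
    Less aexp aexp
  | Equal aexp aexp
  | Member string aexp
  | Neg bexp
  | Conj bexp bexp

datatype com =
    Skip
  | Assign string aexp
  | Insert string aexp aexp
  | Delete string aexp
  | Seq com com
  | Cond bexp com com
  | While bexp com

fun aval :: "aexp \<Rightarrow> state \<Rightarrow> int" where
  "aval (Const i) s = i"
| "aval (Var x) s = read s (Reg x)"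
| "aval (Plus a b) s = aval a s + aval b s"
| "aval (Minus a b) s = aval a s - aval b s"
| "aval (Times a b) s = aval a s * aval b s"
| "aval (Div a b) s = aval a s div aval b s"
| "aval (Mod a b) s = aval a s mod aval b s"
| "aval (Lookup d a) s = read s (Cell d (aval a s))"

fun bval :: "bexp \<Rightarrow> state \<Rightarrow> bool" where
  "bval (Less a b) s \<longleftrightarrow> aval a s < aval b s"
| "bval (Equal a b) s \<longleftrightarrow> aval a s = aval b s"
| "bval (Member d a) s \<longleftrightarrow> Cell d (aval a s) \<in> dom s"
| "bval (Neg p) s \<longleftrightarrow> \<not> bval p s"
| "bval (Conj p q) s \<longleftrightarrow> bval p s \<and> bval q s"

text \<open>
  Every constant, variable access, arithmetic operation, comparison, Boolean operation
  and dictionary access costs one unit of time, whatever the size of the integers.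
\<close>

fun acost :: "aexp \<Rightarrow> nat" where
  "acost (Const i) = 1"
| "acost (Var x) = 1"
| "acost (Plus a b) = 1 + acost a + acost b"
| "acost (Minus a b) = 1 + acost a + acost b"
| "acost (Times a b) = 1 + acost a + acost b"
| "acost (Div a b) = 1 + acost a + acost b"
| "acost (Mod a b) = 1 + acost a + acost b"
| "acost (Lookup d a) = 1 + acost a"

fun bcost :: "bexp \<Rightarrow> nat" where
  "bcost (Less a b) = 1 + acost a + acost b"
| "bcost (Equal a b) = 1 + acost a + acost b"
| "bcost (Member d a) = 1 + acost a"
| "bcost (Neg p) = 1 + bcost p"
| "bcost (Conj p q) = 1 + bcost p + bcost q"

text \<open>
  The number of locations in use. The domain is always finite in a run that
  starts from a state with finite domain.
\<close>

definition usage :: "state \<Rightarrow> nat" where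
  "usage s = card (dom s)"

text \<open>
  \<open>run c s t m s'\<close>: started in state \<open>s\<close>, the program \<open>c\<close> terminates in state \<open>s'\<close> after
  time \<open>t\<close>, and \<open>m\<close> is the maximum of \<open>usage\<close> over all states of this run.
\<close>

inductive run :: "com \<Rightarrow> state \<Rightarrow> nat \<Rightarrow> nat \<Rightarrow> state \<Rightarrow> bool" where
  Skip: "run Skip s 1 (usage s) s"
| Assign: "s' = s(Reg x \<mapsto> aval a s) \<Longrightarrow>
    run (Assign x a) s (1 + acost a) (max (usage s) (usage s')) s'"
| Insert: "s' = s(Cell d (aval k s) \<mapsto> aval a s) \<Longrightarrow>
    run (Insert d k a) s (1 + acost k + acost a) (max (usage s) (usage s')) s'"
| Delete: "s' = s(Cell d (aval k s) := None) \<Longrightarrow>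
    run (Delete d k) s (1 + acost k) (max (usage s) (usage s')) s'"
| Seq: "run c1 s t1 m1 s1 \<Longrightarrow> run c2 s1 t2 m2 s2 \<Longrightarrow>
    run (Seq c1 c2) s (t1 + t2) (max m1 m2) s2"
| CondTrue: "bval p s \<Longrightarrow> run c1 s t m s' \<Longrightarrow>
    run (Cond p c1 c2) s (1 + bcost p + t) m s'"
| CondFalse: "\<not> bval p s \<Longrightarrow> run c2 s t m s' \<Longrightarrow>
    run (Cond p c1 c2) s (1 + bcost p + t) m s'"
| WhileFalse: "\<not> bval p s \<Longrightarrow> run (While p c) s (1 + bcost p) (usage s) s"
| WhileTrue: "bval p s \<Longrightarrow> run c s t1 m1 s1 \<Longrightarrow> run (While p c) s1 t2 m2 s2 \<Longrightarrow>
    run (While p c) s (1 + bcost p + t1 + t2) (max m1 m2) s2"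

inductive_cases SkipE: "run Skip s t m s'"
inductive_cases AssignE: "run (Assign x a) s t m s'"
inductive_cases InsertE: "run (Insert d k a) s t m s'"
inductive_cases DeleteE: "run (Delete d k) s t m s'"
inductive_cases SeqE: "run (Seq c1 c2) s t m s'"
inductive_cases CondE: "run (Cond p c1 c2) s t m s'"
inductive_cases WhileE: "run (While p c) s t m s'"

lemma run_deterministic:
  "run c s t m s' \<Longrightarrow> run c s u k s'' \<Longrightarrow> t = u \<and> m = k \<and> s' = s''"
proof (induction arbitrary: u k s'' rule: run.induct)
  case (Skip s)
  from Skip.prems show ?case by (rule SkipE) simp
next
  case (Assign s' s x a)
  from Assign.prems show ?case by (rule AssignE) (simp add: Assign.hyps)
next
  case (Insert s' s d k a)
  from Insert.prems show ?case by (rule InsertE) (simp add: Insert.hyps)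
next
  case (Delete s' s d k)
  from Delete.prems show ?case by (rule DeleteE) (simp add: Delete.hyps)
next
  case (Seq c1 s t1 m1 s1 c2 t2 m2 s2)
  from Seq.prems obtain t1' m1' s1' t2' m2' where
    eq: "u = t1' + t2'" "k = max m1' m2'" and
    r1: "run c1 s t1' m1' s1'" and r2: "run c2 s1' t2' m2' s''"
    by (rule SeqE)
  from Seq.IH(1)[OF r1] have 1: "t1 = t1'" "m1 = m1'" "s1' = s1" by simp_all
  from Seq.IH(2)[OF r2[unfolded 1(3)]] 1 eq show ?case by simp
next
  case (CondTrue p s c1 t m s' c2)
  from CondTrue.prems obtain t' where
    eq: "u = Suc (bcost p + t')" and r: "run c1 s t' k s''"
    by (rule CondE) (use CondTrue.hyps(1) in auto)
  from CondTrue.IH[OF r] eq show ?case by simp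
next
  case (CondFalse p s c2 t m s' c1)
  from CondFalse.prems obtain t' where
    eq: "u = Suc (bcost p + t')" and r: "run c2 s t' k s''"
    by (rule CondE) (use CondFalse.hyps(1) in auto)
  from CondFalse.IH[OF r] eq show ?case by simp
next
  case (WhileFalse p s c)
  from WhileFalse.prems show ?case by (rule WhileE) (use WhileFalse.hyps in auto)
next
  case (WhileTrue p s c t1 m1 s1 t2 m2 s2)
  from WhileTrue.prems obtain t1' m1' s1' t2' m2' where
    eq: "u = Suc (bcost p + t1' + t2')" "k = max m1' m2'" and
    r1: "run c s t1' m1' s1'" and r2: "run (While p c) s1' t2' m2' s''"
    by (rule WhileE) (use WhileTrue.hyps(1) in auto)
  from WhileTrue.IH(1)[OF r1] have 1: "t1 = t1'" "m1 = m1'" "s1' = s1" by simp_all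
  from WhileTrue.IH(2)[OF r2[unfolded 1(3)]] 1 eq show ?case by simp
qed

definition input_state :: "nat \<Rightarrow> state" where
  "input_state n = [Reg ''n'' \<mapsto> int n]"

end

theory Submission
  imports Defs
begin

text \<open>
  Up to inversion, one counts the output sequences \<open>q\<close> that can be produced from the sorted input.
  Delaying pushes never hurts, so \<open>q\<close> determines when every element is pushed; only the choice of
  the stack (or of the end of the deque), i.e. a 2-colouring of the open elements, is free. An
  element can be output iff all younger open elements have the opposite colour; for the deque,
  the oldest open element can also be output if the younger ones merely share a colour. Hence
  the colourings that survive a prefix of \<open>q\<close> can be described by saying for each open element
  whether its colour is unrelated to, equal to or different from that of the next older one. The
  lists of these relations are the states of a deterministic automaton whose accepting runs
  correspond to the sequences \<open>q\<close>. Creating a group of nontrivial relations costs two outputs,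
  so that only \<open>O(2 ^ n)\<close> states are reachable after any given number of outputs, and
  dynamic programming over the states, layer by layer, takes time \<open>O(n ^ 2 * 2 ^ n)\<close>. At most one
  new location comes into use per unit of time, which bounds the space as well.
\<close>

section \<open>Coloured open elements\<close>

text \<open>Why relations between neighbours suffice: when an element with younger open elements is
  output from a stack, the younger ones must all have the opposite colour. Only two facts survive:
  they are equal to each other, and their relation to the next older element is the complement of
  the relation that the removed element had to it. The set of surviving colourings is therefore
  again given by links.

  The obstacle is the number of states, since three kinds of links allow \<open>3 ^ m\<close> lists
  on \<open>m\<close> open elements. With \<open>k\<close> outputs to come there are at most
  \<open>k\<close> open elements, while groups are paid for by the \<open>n - k\<close> outputs
  already made. Length and groups compete for the same \<open>n\<close>, so
  \<open>length L + 2 * groups L \<le> n + 1\<close> in every layer, and a weighted count turns this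
  into \<open>O(2 ^ n)\<close>.

  Time linear in \<open>n\<close> per state requires each of its \<open>O(n)\<close> successors in
  constant time. Hence lists are coded as base-4 integers, and a successor's code is computed by a
  fixed number of arithmetic operations.\<close>

definition removable :: "bool \<Rightarrow> ('a \<times> bool) list \<Rightarrow> bool \<Rightarrow> ('a \<times> bool) list \<Rightarrow> bool" where
  "removable dq u c v \<longleftrightarrow>
     (\<forall>z\<in>set u. snd z \<noteq> c) \<or> dq \<and> v = [] \<and> (\<exists>e. \<forall>z\<in>set u. snd z = e)"

text \<open>The third argument lists the open elements with their colours, youngest first. The
  second disjunct of \<open>removable\<close> is special to the deque: if all younger elements went
  to one side, the oldest one is exposed at the other end. The shared colour \<open>e\<close> may be
  arbitrary, because the first disjunct already applies when it differs from
  \<open>c\<close>.\<close>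

inductive generates :: "bool \<Rightarrow> 'a list \<Rightarrow> ('a \<times> bool) list \<Rightarrow> 'a list \<Rightarrow> bool" for dq where
  empty: "generates dq [] [] []"
| push: "generates dq xs ((x, c) # s) q \<Longrightarrow> generates dq (x # xs) s q"
| pop: "removable dq u c v \<Longrightarrow> generates dq xs (u @ v) q \<Longrightarrow>
    generates dq xs (u @ (y, c) # v) (y # q)"

section \<open>Stack and deque configurations as coloured lists\<close>

definition side :: "bool \<Rightarrow> ('a \<times> bool) list \<Rightarrow> 'a list" where
  "side c s = map fst (filter (\<lambda>z. snd z = c) s)"

lemma side_simps [simp]:
  "side c [] = []"
  "side c ((x, e) # s) = (if e = c then x # side c s else side c s)"
  "side c (s @ s') = side c s @ side c s'"
  by (auto simp: side_def)

lemma side_eq_Nil: "side c s = [] \<longleftrightarrow> (\<forall>z\<in>set s. snd z \<noteq> c)"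
  by (auto simp: side_def filter_empty_conv)

lemma side_eq_Cons:
  assumes "side c s = y # a"
  obtains u v where "s = u @ (y, c) # v" "\<forall>z\<in>set u. snd z \<noteq> c" "side c v = a"
proof -
  have "\<exists>u v. s = u @ (y, c) # v \<and> (\<forall>z\<in>set u. snd z \<noteq> c) \<and> side c v = a"
    using assms
  proof (induction s)
    case (Cons z s)
    obtain x e where z: "z = (x, e)" by force
    show ?case
    proof (cases "e = c")
      case True
      then show ?thesis using Cons.prems z by (intro exI[of _ "[]"] exI[of _ s]) auto
    next
      case False
      then obtain u v where "s = u @ (y, c) # v \<and> (\<forall>z\<in>set u. snd z \<noteq> c) \<and> side c v = a"
        using Cons z by auto
      then show ?thesis using z False by (intro exI[of _ "z # u"] exI[of _ v]) auto
    qed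
  qed simp
  then show thesis using that by blast
qed

text \<open>Two stacks do not record how their elements interleave by age; \<open>s\<close> restores
  this. The top of one stack is the youngest entry of its colour, so everything younger lies on the
  other stack, which is what \<open>removable\<close> demands.\<close>

lemma stacks_step_generates:
  assumes "stacks_step\<^sup>*\<^sup>* (xs, side True s, side False s, out) ([], [], [], fin)"
  shows "\<exists>q. fin = out @ q \<and> generates False xs s q"
proof -
  have "stacks_step\<^sup>*\<^sup>* cfg ([], [], [], fin) \<Longrightarrow>
    cfg = (xs, side True s, side False s, out) \<Longrightarrow> \<exists>q. fin = out @ q \<and> generates False xs s q" for cfg
  proof (induction arbitrary: xs s out rule: converse_rtranclp_induct)
    case base
    then have "side True s = []" "side False s = []" "xs = []" "out = fin" by auto
    then have "s = []" by (cases s) (auto simp: side_eq_Nil)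
    with \<open>xs = []\<close> \<open>out = fin\<close> show ?case by (auto intro: generates.empty)
  next
    case (step cfg cfg')
    from step.hyps(1) step.prems show ?case
    proof (cases rule: stacks_step.cases)
      case (push_first x xs' a b out')
      with step.IH[of xs' "(x, True) # s" out] step.prems show ?thesis
        by (auto intro: generates.push)
    next
      case (push_second x xs' a b out')
      with step.IH[of xs' "(x, False) # s" out] step.prems show ?thesis
        by (auto intro: generates.push)
    next
      case (pop_first xs' y a b out')
      then have "side True s = y # a" using step.prems by auto
      then obtain u v where s: "s = u @ (y, True) # v" "\<forall>z\<in>set u. snd z \<noteq> True" "side True v = a"
        by (rule side_eq_Cons)
      then have "side True u = []" by (simp add: side_eq_Nil)
      with s pop_first step.prems step.IH[of xs "u @ v" "out @ [y]"]
      obtain q where "fin = out @ y # q" "generates False xs (u @ v) q" by auto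
      then show ?thesis using s
        by (auto intro!: exI[of _ "y # q"] generates.pop simp: removable_def)
    next
      case (pop_second xs' a y b out')
      then have "side False s = y # b" using step.prems by auto
      then obtain u v where s: "s = u @ (y, False) # v" "\<forall>z\<in>set u. snd z \<noteq> False" "side False v = b"
        by (rule side_eq_Cons)
      then have "side False u = []" by (simp add: side_eq_Nil)
      with s pop_second step.prems step.IH[of xs "u @ v" "out @ [y]"]
      obtain q where "fin = out @ y # q" "generates False xs (u @ v) q" by auto
      then show ?thesis using s
        by (auto intro!: exI[of _ "y # q"] generates.pop simp: removable_def)
    qed
  qed
  then show ?thesis using assms by blast
qed

lemma generates_stacks_step:
  assumes "generates False xs s q"
  shows "stacks_step\<^sup>*\<^sup>* (xs, side True s, side False s, out) ([], [], [], out @ q)"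
  using assms
proof (induction arbitrary: out rule: generates.induct)
  case (push xs x c s q)
  show ?case
    using push.IH[of out] stacks_step.push_first[of x xs "side True s" "side False s" out]
      stacks_step.push_second[of x xs "side True s" "side False s" out]
    by (cases c) (auto intro: converse_rtranclp_into_rtranclp)
next
  case (pop u c v xs q y)
  then have u: "side c u = []" by (simp add: removable_def side_eq_Nil)
  show ?case
    using pop.IH[of "out @ [y]"] u
      stacks_step.pop_first[of xs y "side True v" "side False (u @ v)" out]
      stacks_step.pop_second[of xs "side True (u @ v)" y "side False v" out]
    by (cases c) (auto intro: converse_rtranclp_into_rtranclp)
qed simp

lemma stacks_sortable_iff: "stacks_sortable p \<longleftrightarrow> generates False p [] [1..<Suc (length p)]"
  unfolding stacks_sortable_def
  using stacks_step_generates[of p "[]" "[]"] generates_stacks_step[of p "[]" _ "[]"] by auto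

text \<open>Elements pushed on the left always stay left of those pushed on the right, so a deque is
  two stacks glued together at their bottoms. A pop on an empty side reaches the bottom of the other
  side.\<close>

lemma deque_step_generates:
  assumes "deque_step\<^sup>*\<^sup>* (xs, side True s @ rev (side False s), out) ([], [], fin)"
  shows "\<exists>q. fin = out @ q \<and> generates True xs s q"
proof -
  have "deque_step\<^sup>*\<^sup>* cfg ([], [], fin) \<Longrightarrow>
    cfg = (xs, side True s @ rev (side False s), out) \<Longrightarrow>
    \<exists>q. fin = out @ q \<and> generates True xs s q" for cfg
  proof (induction arbitrary: xs s out rule: converse_rtranclp_induct)
    case base
    then have "side True s = []" "side False s = []" "xs = []" "out = fin" by auto
    then have "s = []" by (cases s) (auto simp: side_eq_Nil)
    with \<open>xs = []\<close> \<open>out = fin\<close> show ?case by (auto intro: generates.empty)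
  next
    case (step cfg cfg')
    have remove: "\<exists>q. fin = out @ q \<and> generates True xs s q"
      if s: "s = u @ (y, c) # v" and r: "removable True u c v"
        and cfg': "cfg' = (xs, side True (u @ v) @ rev (side False (u @ v)), out @ [y])" for u c v y
    proof -
      from step.IH[OF cfg'] obtain q where "fin = out @ y # q" "generates True xs (u @ v) q" by auto
      then show ?thesis using s r by (auto intro!: exI[of _ "y # q"] generates.pop)
    qed
    \<comment> \<open>With no element of colour \<open>c\<close> open, the end of the deque
      belonging to \<open>c\<close> shows the oldest open element, i.e. the last entry of
      \<open>s\<close>.\<close>
    have bottom: "\<exists>u. s = u @ [(y, \<not> c)] \<and> (\<forall>z\<in>set u. snd z = (\<not> c)) \<and> rev a = side (\<not> c) u"
      if "side c s = []" "rev (side (\<not> c) s) = y # a" for c y a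
    proof -
      from that(2) have *: "side (\<not> c) s = rev a @ [y]" by (simp add: rev_swap)
      have all: "\<forall>z\<in>set s. snd z = (\<not> c)" using that(1) by (auto simp: side_eq_Nil)
      from * have "s \<noteq> []" by auto
      then obtain u z where s: "s = u @ [z]" by (metis rev_exhaust)
      with all have z: "z = (fst z, \<not> c)" by (cases z) auto
      from * s have "side (\<not> c) u @ [fst z] = rev a @ [y]" by (subst (asm) s, subst (asm) z) simp
      then show ?thesis using s z all by auto
    qed
    from step.hyps(1) step.prems show ?case
    proof (cases rule: deque_step.cases)
      case (push_left x xs' d out')
      with step.IH[of xs' "(x, True) # s" out] step.prems show ?thesis
        by (auto intro: generates.push)
    next
      case (push_right x xs' d out')
      with step.IH[of xs' "(x, False) # s" out] step.prems show ?thesis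
        by (auto intro: generates.push)
    next
      case (pop_left xs' y d out')
      then have d: "side True s @ rev (side False s) = y # d" and cfg': "cfg' = (xs, d, out @ [y])"
        using step.prems by auto
      show ?thesis
      proof (cases "side True s")
        case Nil
        with d bottom[of True y d] obtain u where u: "s = u @ [(y, False)]"
          "\<forall>z\<in>set u. snd z = False" "rev d = side False u" by auto
        then have "side True u = []" "d = rev (side False u)" by (auto simp: side_eq_Nil rev_swap)
        then show ?thesis
          using remove[OF u(1)] u(2) cfg' by (auto simp: removable_def)
      next
        case (Cons y' a)
        with d have a: "side True s = y # a" "d = a @ rev (side False s)" by auto
        from a(1) obtain u v where s: "s = u @ (y, True) # v" "\<forall>z\<in>set u. snd z \<noteq> True" "side True v = a"
          by (rule side_eq_Cons)
        then have "side True u = []" by (simp add: side_eq_Nil)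
        then show ?thesis
          using remove[OF s(1)] s a cfg' by (auto simp: removable_def)
      qed
    next
      case (pop_right xs' d y out')
      then have d: "side True s @ rev (side False s) = d @ [y]" and cfg': "cfg' = (xs, d, out @ [y])"
        using step.prems by auto
      show ?thesis
      proof (cases "side False s")
        case Nil
        then have "rev (side True s) = y # rev d" using arg_cong[OF d, of rev] by simp
        with bottom[of False y "rev d"] Nil obtain u where u: "s = u @ [(y, True)]"
          "\<forall>z\<in>set u. snd z = True" "d = side True u" by auto
        then have "side False u = []" by (auto simp: side_eq_Nil)
        then show ?thesis
          using remove[OF u(1)] u(2,3) cfg' by (auto simp: removable_def)
      next
        case (Cons y' b)
        with d have b: "side False s = y # b" "d = side True s @ rev b" by auto
        from b(1) obtain u v where s: "s = u @ (y, False) # v" "\<forall>z\<in>set u. snd z \<noteq> False" "side False v = b"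
          by (rule side_eq_Cons)
        then have "side False u = []" by (simp add: side_eq_Nil)
        then show ?thesis
          using remove[OF s(1)] s b cfg' by (auto simp: removable_def)
      qed
    qed
  qed
  then show ?thesis using assms by blast
qed

lemma generates_deque_step:
  assumes "generates True xs s q"
  shows "deque_step\<^sup>*\<^sup>* (xs, side True s @ rev (side False s), out) ([], [], out @ q)"
  using assms
proof (induction arbitrary: out rule: generates.induct)
  case (push xs x c s q)
  show ?case
    using push.IH[of out] deque_step.push_left[of x xs "side True s @ rev (side False s)" out]
      deque_step.push_right[of x xs "side True s @ rev (side False s)" out]
    by (cases c) (auto intro: converse_rtranclp_into_rtranclp)
next
  case (pop u c v xs q y)
  let ?d = "\<lambda>s. side True s @ rev (side False s)"
  have "deque_step (xs, ?d (u @ (y, c) # v), out) (xs, ?d (u @ v), out @ [y])"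
  proof (cases "side c u = []")
    case True
    then show ?thesis
      using deque_step.pop_left[of xs y "side True v @ rev (side False (u @ v))" out]
        deque_step.pop_right[of xs "side True (u @ v) @ rev (side False v)" y out]
      by (cases c) auto
  next
    case False
    then have *: "v = []" "side (\<not> c) u = []"
      using pop.hyps(1) by (auto simp: removable_def side_eq_Nil)
    then show ?thesis
      using deque_step.pop_left[of xs y "rev (side False u)" out]
        deque_step.pop_right[of xs "side True u" y out]
      by (cases c) auto
  qed
  then show ?case using pop.IH[of "out @ [y]"] by (auto intro: converse_rtranclp_into_rtranclp)
qed simp

lemma deque_sortable_iff: "deque_sortable p \<longleftrightarrow> generates True p [] [1..<Suc (length p)]"
  unfolding deque_sortable_def
  using deque_step_generates[of p "[]" "[]"] generates_deque_step[of p "[]" _ "[]"] by auto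

text \<open>The rules never inspect the elements themselves, so a run can be relabelled. Relabelling
  by an inverse permutation exchanges the roles of sorted input and sorted output.\<close>

lemma generates_map:
  assumes "generates dq xs s q"
  shows "generates dq (map g xs) (map (apfst g) s) (map g q)"
  using assms
proof (induction rule: generates.induct)
  case (push xs x c s q)
  then show ?case by (auto intro: generates.push)
next
  case (pop u c v xs q y)
  have "removable dq (map (apfst g) u) c (map (apfst g) v)"
    using pop.hyps(1) by (auto simp: removable_def)
  then show ?case using generates.pop pop.IH by fastforce
qed (auto intro: generates.empty)

lemma permutations_of_set_upt_image:
  "bij_betw (\<lambda>g. map g [1..<Suc n]) {g. g permutes {1..n}} (permutations_of_set {1..n})"
proof -
  have inj: "inj_on (\<lambda>g. map g [1..<Suc n]) {g. g permutes {1..n}}"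
  proof (rule inj_onI, rule ext)
    fix g h x assume g: "g \<in> {g. g permutes {1..n}}" and h: "h \<in> {g. g permutes {1..n}}"
      and eq: "map g [1..<Suc n] = map h [1..<Suc n]"
    show "g x = h x"
    proof (cases "x \<in> {1..n}")
      case True
      then show ?thesis using eq by (simp del: upt_Suc)
    next
      case False
      then show ?thesis using g h by (metis mem_Collect_eq permutes_not_in)
    qed
  qed
  have sub: "(\<lambda>g. map g [1..<Suc n]) ` {g. g permutes {1..n}} \<subseteq> permutations_of_set {1..n}"
  proof (safe intro!: permutations_of_setI)
    fix g assume g: "g permutes {1..n}"
    have *: "set [1..<Suc n] = {1..n}" by auto
    show "x \<in> {1..n}" if "x \<in> set (map g [1..<Suc n])" for x
      using that permutes_image[OF g] unfolding set_map * by simp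
    show "x \<in> set (map g [1..<Suc n])" if "x \<in> {1..n}" for x
      using that permutes_image[OF g] unfolding set_map * by simp
    show "distinct (map g [1..<Suc n])"
      using inj_on_subset[OF permutes_inj[OF g] subset_UNIV] by (simp add: distinct_map del: upt_Suc)
  qed
  have "card ((\<lambda>g. map g [1..<Suc n]) ` {g. g permutes {1..n}}) = card (permutations_of_set {1..n})"
    unfolding card_image[OF inj] by (simp add: card_permutations[of _ n])
  then have "(\<lambda>g. map g [1..<Suc n]) ` {g. g permutes {1..n}} = permutations_of_set {1..n}"
    using sub by (intro card_subset_eq) auto
  with inj show ?thesis by (rule bij_betw_imageI)
qed

text \<open>
  Sorting \<open>p\<close> amounts to producing the inverse of \<open>p\<close> from the sorted input, so both
  problems have the same number of solutions.
\<close>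

lemma card_generates_inverse:
  "card {p \<in> permutations_of_set {1..n}. generates dq p [] [1..<Suc n]} =
   card {q \<in> permutations_of_set {1..n}. generates dq [1..<Suc n] [] q}"
proof -
  let ?id = "[1..<Suc n]"
  let ?P = "{g. g permutes {1..n}}"
  have id: "map g (map (inv g) ?id) = ?id" "map (inv g) (map g ?id) = ?id" if "g permutes {1..n}" for g
    using permutes_inverses[OF that] by (simp_all add: o_def del: upt_Suc)
  have restrict: "card {g \<in> ?P. Q (map g ?id)} = card {p \<in> permutations_of_set {1..n}. Q p}" for Q
  proof -
    have "bij_betw (\<lambda>g. map g ?id) {g \<in> ?P. Q (map g ?id)} {p \<in> permutations_of_set {1..n}. Q p}"
      using permutations_of_set_upt_image[of n] unfolding bij_betw_def
      by (auto intro: inj_on_subset simp del: upt_Suc)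
    then show ?thesis by (rule bij_betw_same_card)
  qed
  have "bij_betw inv {g \<in> ?P. generates dq (map g ?id) [] ?id} {g \<in> ?P. generates dq ?id [] (map g ?id)}"
  proof (rule bij_betwI[where g = inv])
    show "inv \<in> {g \<in> ?P. generates dq (map g ?id) [] ?id} \<rightarrow> {g \<in> ?P. generates dq ?id [] (map g ?id)}"
    proof safe
      fix g assume "g permutes {1..n}" "generates dq (map g ?id) [] ?id"
      then show "generates dq ?id [] (map (inv g) ?id)"
        using generates_map[of dq "map g ?id" "[]" ?id "inv g"] id[of g] by (simp del: upt_Suc map_map)
    qed (rule permutes_inv)
    show "inv \<in> {g \<in> ?P. generates dq ?id [] (map g ?id)} \<rightarrow> {g \<in> ?P. generates dq (map g ?id) [] ?id}"
    proof safe
      fix g assume "g permutes {1..n}" "generates dq ?id [] (map g ?id)"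
      then show "generates dq (map (inv g) ?id) [] ?id"
        using generates_map[of dq ?id "[]" "map g ?id" "inv g"] id[of g] by (simp del: upt_Suc map_map)
    qed (rule permutes_inv)
  qed (auto simp: permutes_inv_inv)
  then show ?thesis
    using restrict[of "\<lambda>p. generates dq p [] ?id"] restrict[of "\<lambda>q. generates dq ?id [] q"]
    by (simp add: bij_betw_same_card)
qed

section \<open>The automaton of relations\<close>

text \<open>
  Open elements are listed with the youngest first, and the link at an element constrains its
  colour relative to the next older element, i.e. the next entry of the list.
\<close>

datatype link = Free | Same | Diff

fun flip :: "link \<Rightarrow> link" where
  "flip Free = Free"
| "flip Same = Diff"
| "flip Diff = Same"

text \<open>The oldest element has nothing to be compared with, so its link is vacuous.\<close>

fun link_ok :: "link \<Rightarrow> bool \<Rightarrow> bool list \<Rightarrow> bool" where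
  "link_ok l c [] \<longleftrightarrow> True"
| "link_ok Free c (c' # cs) \<longleftrightarrow> True"
| "link_ok Same c (c' # cs) \<longleftrightarrow> c = c'"
| "link_ok Diff c (c' # cs) \<longleftrightarrow> c \<noteq> c'"

fun consistent :: "bool list \<Rightarrow> link list \<Rightarrow> bool" where
  "consistent [] [] \<longleftrightarrow> True"
| "consistent (c # cs) (l # L) \<longleftrightarrow> link_ok l c cs \<and> consistent cs L"
| "consistent _ _ \<longleftrightarrow> False"

text \<open>Removal of the element at depth \<open>d\<close>. The first \<open>d - 1\<close> links
  relate the younger elements to one another, and link \<open>d - 1\<close> relates the last of them
  to the removed element. The guard says that the younger ones can share a colour which differs from
  the removed one, or merely share a colour if a deque gives up its oldest element.\<close>

definition close :: "bool \<Rightarrow> nat \<Rightarrow> link list \<Rightarrow> link list option" where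
  "close dq d L = (case drop d L of
       [] \<Rightarrow> None
     | x # r \<Rightarrow>
         if d = 0 then Some r
         else if Diff \<notin> set (take (d - 1) L) \<and> (L ! (d - 1) \<noteq> Same \<or> dq \<and> r = [])
         then Some (replicate (d - 1) Same @ flip x # r)
         else None)"

section \<open>How a removal transforms the relations\<close>

lemma consistent_length: "consistent cs L \<Longrightarrow> length cs = length L"
  by (induction cs L rule: consistent.induct) auto

lemma link_ok_Free [simp]: "link_ok Free c cs"
  by (cases cs) auto

lemma link_ok_flip: "link_ok l (\<not> c) cs \<longleftrightarrow> link_ok (flip l) c cs"
  by (cases l; cases cs) auto

lemma link_ok_exists: "\<exists>c. link_ok l c cs"
  by (cases l; cases cs) auto

lemma consistent_append_Free:
  "length cs = k \<Longrightarrow> consistent (cs @ c) (replicate k Free @ L) \<longleftrightarrow> consistent c L"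
  by (induction cs arbitrary: k) auto

lemma consistent_replicate:
  "consistent (replicate (Suc (length s)) k @ cs) (s @ l # R) \<longleftrightarrow>
     Diff \<notin> set s \<and> link_ok l k cs \<and> consistent cs R"
proof (induction s)
  case (Cons a s)
  then show ?case by (cases a) auto
qed simp

lemma consistent_Same:
  "length cu = Suc d \<Longrightarrow> consistent (cu @ cv) (replicate d Same @ l # R) \<longleftrightarrow>
     (\<exists>k. cu = replicate (Suc d) k \<and> link_ok l k cv \<and> consistent cv R)"
proof (induction d arbitrary: cu)
  case 0
  then obtain c where "cu = [c]" by (cases cu) auto
  then show ?case by simp
next
  case (Suc d)
  then obtain c c' cs where cu: "cu = c # c' # cs"
    by (metis length_Suc_conv)
  with Suc.prems have len: "length (c' # cs) = Suc d" by simp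
  have "consistent (cu @ cv) (replicate (Suc d) Same @ l # R) \<longleftrightarrow>
    c = c' \<and> consistent ((c' # cs) @ cv) (replicate d Same @ l # R)" by (simp add: cu)
  also have "\<dots> \<longleftrightarrow> c = c' \<and>
    (\<exists>k. c' # cs = replicate (Suc d) k \<and> link_ok l k cv \<and> consistent cv R)"
    by (simp only: Suc.IH[OF len])
  also have "\<dots> \<longleftrightarrow>
    (\<exists>k. cu = replicate (Suc (Suc d)) k \<and> link_ok l k cv \<and> consistent cv R)"
    unfolding cu replicate_Suc list.inject by blast
  finally show ?case .
qed

lemma all_eq_iff_replicate: "length xs = n \<Longrightarrow> (\<forall>z\<in>set xs. z = e) \<longleftrightarrow> xs = replicate n e"
  by (induction xs arbitrary: n) auto

text \<open>This is projection: the colour \<open>cx\<close> of the removed element is eliminated,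
  and the remaining condition on the other colours is again of the form
  \<open>consistent\<close>.\<close>

lemma close_consistent:
  assumes L: "length L = Suc (d + m)" and cu: "length cu = d" and cv: "length cv = m"
  shows "(\<exists>cx. consistent (cu @ cx # cv) L \<and>
           ((\<forall>e\<in>set cu. e \<noteq> cx) \<or> dq \<and> cv = [] \<and> (\<exists>e. \<forall>z\<in>set cu. z = e))) \<longleftrightarrow>
         (\<exists>L'. close dq d L = Some L' \<and> consistent (cu @ cv) L')"
proof (cases d)
  case 0
  then obtain x r where x: "L = x # r" using L by (cases L) auto
  show ?thesis using 0 cu link_ok_exists[of x cv] by (auto simp: x close_def)
next
  case (Suc d')
  define s where "s = take d' L"
  define l where "l = L ! d'"
  define x where "x = L ! d"
  define r where "r = drop (Suc d) L"
  have "x # r = drop d L" unfolding x_def r_def using L by (intro Cons_nth_drop_Suc) simp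
  moreover have "l # drop d L = drop d' L"
    unfolding l_def Suc using L Suc by (intro Cons_nth_drop_Suc) simp
  ultimately have Leq: "L = s @ l # x # r" by (simp add: s_def)
  have s: "length s = d'" using L Suc by (simp add: s_def)
  have r: "length r = m" using L by (simp add: r_def)
  have close: "close dq d L =
      (if Diff \<notin> set s \<and> (l \<noteq> Same \<or> dq \<and> cv = []) then Some (replicate d' Same @ flip x # r) else None)"
    using r cv s unfolding close_def Suc Leq by (auto simp: nth_append)
  let ?removable = "\<lambda>cx. (\<forall>e\<in>set cu. e \<noteq> cx) \<or> dq \<and> cv = [] \<and> (\<exists>e. \<forall>z\<in>set cu. z = e)"
  have all_neq: "(\<forall>e\<in>set cu. e \<noteq> cx) \<longleftrightarrow> cu = replicate (Suc d') (\<not> cx)" for cx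
  proof -
    have "(\<forall>e\<in>set cu. e \<noteq> cx) \<longleftrightarrow> (\<forall>e\<in>set cu. e = (\<not> cx))" by (rule ball_cong) auto
    then show ?thesis using cu Suc by (simp only: all_eq_iff_replicate)
  qed
  have all_eq: "(\<forall>z\<in>set cu. z = e) \<longleftrightarrow> cu = replicate (Suc d') e" for e
    using cu Suc by (simp only: all_eq_iff_replicate)
  show ?thesis
  proof (cases "\<exists>k. cu = replicate (Suc d') k")
    case False
    then have "\<not> ?removable cx" for cx
      unfolding all_neq all_eq by blast
    moreover have "\<not> (\<exists>L'. close dq d L = Some L' \<and> consistent (cu @ cv) L')"
      using False unfolding close consistent_Same[OF cu[unfolded Suc]]
      by (auto simp: consistent_Same[OF cu[unfolded Suc]])
    ultimately show ?thesis by blast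
  next
    case True
    then obtain k where k: "cu = replicate (Suc d') k" by blast
    have rem: "?removable cx \<longleftrightarrow> k \<noteq> cx \<or> dq \<and> cv = []" for cx
      by (simp add: k) blast
    have cons: "consistent (cu @ cx # cv) L \<longleftrightarrow>
        Diff \<notin> set s \<and> link_ok l k (cx # cv) \<and> link_ok x cx cv \<and> consistent cv r" for cx
      using consistent_replicate[of s k "cx # cv" l "x # r"] unfolding Leq k s by simp
    have cons': "consistent (cu @ cv) (replicate d' Same @ flip x # r) \<longleftrightarrow>
        link_ok (flip x) k cv \<and> consistent cv r"
      using consistent_replicate[of "replicate d' Same" k cv "flip x" r] unfolding k by simp
    \<comment> \<open>An ordinary removal forces \<open>cx = (\<not> k)\<close>, so \<open>l\<close>
      must permit a difference, and the relation \<open>x\<close> of \<open>cx\<close> to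
      \<open>cv\<close> becomes \<open>flip x\<close> for \<open>k\<close>. In the deque exception
      \<open>cv = []\<close>, so \<open>x\<close> is vacuous and \<open>cx\<close> can be chosen to
      satisfy \<open>l\<close>.\<close>
    have "(\<exists>cx. link_ok l k (cx # cv) \<and> link_ok x cx cv \<and> (k \<noteq> cx \<or> dq \<and> cv = [])) \<longleftrightarrow>
        (l \<noteq> Same \<or> dq \<and> cv = []) \<and> link_ok (flip x) k cv"
    proof (cases "cv = []")
      case True
      then show ?thesis by (cases l; cases k) (simp_all add: ex_bool_eq all_bool_eq)
    next
      case False
      then show ?thesis by (cases l; cases k) (simp_all add: ex_bool_eq all_bool_eq flip: link_ok_flip)
    qed
    then show ?thesis unfolding rem cons close using cons' by (simp split: if_split) blast
  qed
qed

lemma length_close: "close dq d L = Some L' \<Longrightarrow> length L = Suc (length L')"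
proof -
  assume *: "close dq d L = Some L'"
  then obtain x r where r: "drop d L = x # r" by (cases "drop d L") (auto simp: close_def)
  have "length L = d + Suc (length r)" using arg_cong[OF r, of length] by (simp only: length_drop list.size)
  then show ?thesis using * r by (auto simp: close_def split: if_splits)
qed

text \<open>Outputting an unread \<open>y\<close> opens exactly the elements in front of it, with
  unrelated colours. The element \<open>y\<close> itself leaves as soon as it is pushed and never
  enters the list of links.\<close>

fun accepts :: "bool \<Rightarrow> 'a list \<Rightarrow> 'a list \<Rightarrow> link list \<Rightarrow> 'a list \<Rightarrow> bool" where
  "accepts dq xs os L [] \<longleftrightarrow> xs = [] \<and> os = []"
| "accepts dq xs os L (y # q) \<longleftrightarrow>
     (if y \<in> set xs then
        accepts dq (tl (dropWhile (\<lambda>z. z \<noteq> y) xs)) (rev (takeWhile (\<lambda>z. z \<noteq> y) xs) @ os)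
          (replicate (length (takeWhile (\<lambda>z. z \<noteq> y) xs)) Free @ L) q
      else y \<in> set os \<and>
        (case close dq (length (takeWhile (\<lambda>z. z \<noteq> y) os)) L of
           None \<Rightarrow> False
         | Some L' \<Rightarrow> accepts dq xs (remove1 y os) L' q))"

lemma accepts_Cons_input:
  assumes "y \<notin> set us"
  shows "accepts dq (us @ y # vs) os L (y # q) \<longleftrightarrow>
    accepts dq vs (rev us @ os) (replicate (length us) Free @ L) q"
proof -
  have "takeWhile (\<lambda>z. z \<noteq> y) (us @ y # vs) = us" "dropWhile (\<lambda>z. z \<noteq> y) (us @ y # vs) = y # vs"
    using assms by (auto simp: takeWhile_append dropWhile_append)
  then show ?thesis by simp
qed

lemma accepts_Cons_open:
  assumes "y \<notin> set u" "y \<notin> set xs"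
  shows "accepts dq xs (u @ y # v) L (y # q) \<longleftrightarrow>
    (\<exists>L'. close dq (length u) L = Some L' \<and> accepts dq xs (u @ v) L' q)"
proof -
  have "takeWhile (\<lambda>z. z \<noteq> y) (u @ y # v) = u" using assms by (auto simp: takeWhile_append)
  then show ?thesis using assms by (auto simp: remove1_append split: option.splits)
qed

text \<open>Pushes can be delayed: a push before the removal of \<open>y\<close> only adds a younger
  element, which makes the condition \<open>removable\<close> harder to meet, so the removal can be
  moved in front of it.\<close>

lemma generates_pop_first:
  assumes "generates dq xs s (y # q)" "y \<notin> set xs"
  shows "\<exists>u c v. s = u @ (y, c) # v \<and> removable dq u c v \<and> generates dq xs (u @ v) q"
proof -
  have "generates dq xs s q' \<Longrightarrow> q' = y # q \<Longrightarrow> y \<notin> set xs \<Longrightarrow> ?thesis" for q'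
  proof (induction rule: generates.induct)
    case (push xs x c s q')
    then obtain u c' v where *: "(x, c) # s = u @ (y, c') # v" "removable dq u c' v"
      "generates dq xs (u @ v) q" by auto
    then obtain u' where u: "u = (x, c) # u'" "s = u' @ (y, c') # v"
      using push.prems by (cases u) auto
    have "removable dq u' c' v" using *(2) u by (auto simp: removable_def)
    moreover have "generates dq (x # xs) (u' @ v) q" using *(3) u by (auto intro: generates.push)
    ultimately show ?case using u by blast
  qed auto
  then show ?thesis using assms by blast
qed

text \<open>To output an unread \<open>y\<close>, precisely the elements up to \<open>y\<close> have
  to be pushed first. The only freedom is in the colours of the elements of
  \<open>us\<close>.\<close>

lemma generates_Cons_input:
  assumes "distinct (us @ y # vs)" "y \<notin> fst ` set s"
  shows "generates dq (us @ y # vs) s (y # q) \<longleftrightarrow>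
    (\<exists>cs. length cs = length us \<and> generates dq vs (zip (rev us) cs @ s) q)"
  using assms
proof (induction us arbitrary: s)
  case Nil
  show ?case
  proof
    assume "generates dq ([] @ y # vs) s (y # q)"
    then have "generates dq (y # vs) s (y # q)" by simp
    then obtain c where "generates dq vs ((y, c) # s) (y # q)"
      by (cases rule: generates.cases) (use Nil.prems in auto)
    from generates_pop_first[OF this] Nil.prems
    obtain u c' v where *: "(y, c) # s = u @ (y, c') # v" "generates dq vs (u @ v) q" by auto
    then have "u = []" using Nil.prems by (cases u) auto
    with * show "\<exists>cs. length cs = length [] \<and> generates dq vs (zip (rev []) cs @ s) q" by simp
  next
    assume "\<exists>cs. length cs = length [] \<and> generates dq vs (zip (rev []) cs @ s) q"
    then have "generates dq vs ((y, True) # s) (y # q)"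
      using generates.pop[of dq "[]" True s vs q y] by (simp add: removable_def)
    then show "generates dq ([] @ y # vs) s (y # q)" by (auto intro: generates.push)
  qed
next
  case (Cons x us)
  have "generates dq ((x # us) @ y # vs) s (y # q) \<longleftrightarrow>
    (\<exists>c. generates dq (us @ y # vs) ((x, c) # s) (y # q))" (is "?l \<longleftrightarrow> ?r")
  proof
    assume ?l
    then show ?r by (cases rule: generates.cases) (use Cons.prems in auto)
  qed (auto intro: generates.push)
  also have "\<dots> \<longleftrightarrow> (\<exists>c cs. length cs = length us \<and> generates dq vs (zip (rev us) cs @ (x, c) # s) q)"
    using Cons by auto
  also have "\<dots> \<longleftrightarrow> (\<exists>cs. length cs = length (x # us) \<and> generates dq vs (zip (rev (x # us)) cs @ s) q)"
    (is "?l \<longleftrightarrow> ?r")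
  proof
    assume ?l
    then obtain c cs where "length cs = length us" "generates dq vs (zip (rev us) cs @ (x, c) # s) q"
      by blast
    then show ?r by (intro exI[of _ "cs @ [c]"]) auto
  next
    assume ?r
    then obtain cs where *: "length cs = Suc (length us)" "generates dq vs (zip (rev us @ [x]) cs @ s) q"
      by auto
    then obtain cs' c where "cs = cs' @ [c]" by (metis length_Suc_conv_rev)
    with * show ?l by auto
  qed
  finally show ?case .
qed

lemma generates_Cons_open:
  assumes "y \<notin> set xs" "distinct (u @ y # v)" "length cs = length (u @ y # v)"
  shows "generates dq xs (zip (u @ y # v) cs) (y # q) \<longleftrightarrow>
    (\<exists>cu cx cv. cs = cu @ cx # cv \<and> length cu = length u \<and> length cv = length v \<and>
       ((\<forall>e\<in>set cu. e \<noteq> cx) \<or> dq \<and> cv = [] \<and> (\<exists>e. \<forall>z\<in>set cu. z = e)) \<and>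
       generates dq xs (zip (u @ v) (cu @ cv)) q)"
proof -
  define cu where "cu = take (length u) cs"
  define cx where "cx = cs ! length u"
  define cv where "cv = drop (Suc (length u)) cs"
  have cs: "cs = cu @ cx # cv" and len: "length cu = length u" "length cv = length v"
    using assms(3) id_take_nth_drop[of "length u" cs] by (auto simp: cu_def cx_def cv_def)
  have rem: "removable dq (zip u cu) cx (zip v cv) \<longleftrightarrow>
    (\<forall>e\<in>set cu. e \<noteq> cx) \<or> dq \<and> cv = [] \<and> (\<exists>e. \<forall>z\<in>set cu. z = e)"
  proof -
    have "(\<forall>z\<in>set (zip u cu). P (snd z)) \<longleftrightarrow> (\<forall>e\<in>set (map snd (zip u cu)). P e)" for P by auto
    then have "(\<forall>z\<in>set (zip u cu). P (snd z)) \<longleftrightarrow> (\<forall>e\<in>set cu. P e)" for P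
      using len by simp
    note this[of "\<lambda>e. e \<noteq> cx"] this[of "\<lambda>z. z = _"]
    moreover have "zip v cv = [] \<longleftrightarrow> cv = []" using len by (cases v; cases cv) auto
    ultimately show ?thesis unfolding removable_def by presburger
  qed
  have "generates dq xs (zip (u @ y # v) cs) (y # q) \<longleftrightarrow>
    removable dq (zip u cu) cx (zip v cv) \<and> generates dq xs (zip u cu @ zip v cv) q"
  proof
    assume "generates dq xs (zip (u @ y # v) cs) (y # q)"
    from generates_pop_first[OF this assms(1)] obtain u' c v' where
      *: "zip (u @ y # v) cs = u' @ (y, c) # v'" "removable dq u' c v'" "generates dq xs (u' @ v') q"
      by auto
    have eq: "zip u cu @ (y, cx) # zip v cv = u' @ (y, c) # v'" using *(1) cs len by simp
    have "y \<notin> fst ` set (zip u cu)" "y \<notin> fst ` set (zip v cv)"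
      using assms(2) by (auto dest: set_zip_leftD)
    then have "zip u cu = u' \<and> (y, cx) = (y, c) \<and> zip v cv = v'"
      using eq by (auto simp: append_eq_append_conv2 Cons_eq_append_conv append_eq_Cons_conv)
    then show "removable dq (zip u cu) cx (zip v cv) \<and> generates dq xs (zip u cu @ zip v cv) q"
      using * by auto
  next
    assume "removable dq (zip u cu) cx (zip v cv) \<and> generates dq xs (zip u cu @ zip v cv) q"
    then show "generates dq xs (zip (u @ y # v) cs) (y # q)"
      using generates.pop[of dq "zip u cu" cx "zip v cv" xs q y] cs len by simp
  qed
  also have "\<dots> \<longleftrightarrow> ((\<forall>e\<in>set cu. e \<noteq> cx) \<or> dq \<and> cv = [] \<and> (\<exists>e. \<forall>z\<in>set cu. z = e)) \<and>
      generates dq xs (zip (u @ v) (cu @ cv)) q"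
    unfolding rem using len by simp
  finally have *: "generates dq xs (zip (u @ y # v) cs) (y # q) \<longleftrightarrow> \<dots>" .
  show ?thesis
  proof
    assume "generates dq xs (zip (u @ y # v) cs) (y # q)"
    with cs len * show "\<exists>cu cx cv. cs = cu @ cx # cv \<and> length cu = length u \<and> length cv = length v \<and>
       ((\<forall>e\<in>set cu. e \<noteq> cx) \<or> dq \<and> cv = [] \<and> (\<exists>e. \<forall>z\<in>set cu. z = e)) \<and>
       generates dq xs (zip (u @ v) (cu @ cv)) q" by blast
  next
    assume "\<exists>cu cx cv. cs = cu @ cx # cv \<and> length cu = length u \<and> length cv = length v \<and>
       ((\<forall>e\<in>set cu. e \<noteq> cx) \<or> dq \<and> cv = [] \<and> (\<exists>e. \<forall>z\<in>set cu. z = e)) \<and>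
       generates dq xs (zip (u @ v) (cu @ cv)) q"
    then obtain cu' cx' cv' where **: "cs = cu' @ cx' # cv'" "length cu' = length u"
       "(\<forall>e\<in>set cu'. e \<noteq> cx') \<or> dq \<and> cv' = [] \<and> (\<exists>e. \<forall>z\<in>set cu'. z = e)"
       "generates dq xs (zip (u @ v) (cu' @ cv')) q" by blast
    have "cu' = cu" "cx' # cv' = cx # cv"
      using cs len **(1,2) by (metis append_eq_append_conv)+
    then have "cu' = cu" "cx' = cx" "cv' = cv" by simp_all
    then show "generates dq xs (zip (u @ y # v) cs) (y # q)" using **(3,4) * by blast
  qed
qed

text \<open>
  The colourings consistent with \<open>L\<close> are those that the outputs produced so far allow
  for the open elements: the automaton is the subset construction for \<open>generates\<close>.
\<close>

lemma accepts_iff_generates: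
  assumes "distinct (xs @ os)" "length os = length L"
  shows "accepts dq xs os L q \<longleftrightarrow> (\<exists>c. consistent c L \<and> generates dq xs (zip os c) q)"
  using assms
proof (induction q arbitrary: xs os L)
  case Nil
  have "generates dq xs s [] \<longleftrightarrow> xs = [] \<and> s = []" for xs and s :: "('a \<times> bool) list"
  proof
    have "generates dq xs s q \<Longrightarrow> length q = length xs + length s" for q
      by (induction rule: generates.induct) auto
    then show "generates dq xs s [] \<Longrightarrow> xs = [] \<and> s = []" by fastforce
  qed (auto intro: generates.empty)
  moreover have "consistent c L \<Longrightarrow> zip os c = [] \<longleftrightarrow> os = []" for c
    using Nil.prems(2) by (cases os; cases c) (auto dest: consistent_length)
  moreover have "os = [] \<Longrightarrow> consistent [] L" using Nil.prems(2) by simp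
  ultimately show ?case by auto
next
  case (Cons y q)
  consider (input) "y \<in> set xs" | (open_elem) "y \<notin> set xs" "y \<in> set os" | (none) "y \<notin> set xs" "y \<notin> set os"
    by blast
  then show ?case
  proof cases
    case input
    then obtain us vs where xs: "xs = us @ y # vs" "y \<notin> set us" by (meson split_list_first)
    have "accepts dq xs os L (y # q) \<longleftrightarrow>
      accepts dq vs (rev us @ os) (replicate (length us) Free @ L) q"
      unfolding xs(1) using xs(2) by (rule accepts_Cons_input)
    also have "\<dots> \<longleftrightarrow> (\<exists>c. consistent c (replicate (length us) Free @ L) \<and>
        generates dq vs (zip (rev us @ os) c) q)"
      using Cons.prems xs by (intro Cons.IH) auto
    also have "\<dots> \<longleftrightarrow> (\<exists>c cs. length cs = length us \<and> consistent c L \<and>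
        generates dq vs (zip (rev us) cs @ zip os c) q)" (is "?l \<longleftrightarrow> ?r")
    proof
      assume ?l
      then obtain c where c: "consistent c (replicate (length us) Free @ L)"
        "generates dq vs (zip (rev us @ os) c) q" by blast
      define c1 where "c1 = take (length us) c"
      define c2 where "c2 = drop (length us) c"
      have "c = c1 @ c2" "length c1 = length us"
        using consistent_length[OF c(1)] by (auto simp: c1_def c2_def)
      with c show ?r by (auto simp: consistent_append_Free)
    next
      assume ?r
      then obtain c cs where c: "length cs = length us" "consistent c L"
        "generates dq vs (zip (rev us) cs @ zip os c) q" by blast
      then show ?l by (intro exI[of _ "cs @ c"]) (auto simp: consistent_append_Free)
    qed
    also have "\<dots> \<longleftrightarrow> (\<exists>c. consistent c L \<and> generates dq xs (zip os c) (y # q))"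
    proof -
      have "y \<notin> fst ` set (zip os c)" for c :: "bool list"
        using Cons.prems input by (auto dest: set_zip_leftD)
      then show ?thesis unfolding xs(1) using Cons.prems xs by (subst generates_Cons_input) auto
    qed
    finally show ?thesis .
  next
    case open_elem
    then obtain u v where os: "os = u @ y # v" "y \<notin> set u" by (meson split_list_first)
    have len: "length L = Suc (length u + length v)" using Cons.prems os by simp
    have "(\<exists>c. consistent c L \<and> generates dq xs (zip os c) (y # q)) \<longleftrightarrow>
      (\<exists>c. consistent c L \<and> length c = length (u @ y # v) \<and> generates dq xs (zip (u @ y # v) c) (y # q))"
    proof -
      have "consistent c L \<Longrightarrow> length c = length (u @ y # v)" for c
        using consistent_length[of c L] len by simp
      then show ?thesis unfolding os(1) by blast
    qed
    also have "\<dots> \<longleftrightarrow> (\<exists>cu cx cv. length cu = length u \<and> length cv = length v \<and>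
        consistent (cu @ cx # cv) L \<and>
        ((\<forall>e\<in>set cu. e \<noteq> cx) \<or> dq \<and> cv = [] \<and> (\<exists>e. \<forall>z\<in>set cu. z = e)) \<and>
        generates dq xs (zip (u @ v) (cu @ cv)) q)" (is "?l \<longleftrightarrow> ?r")
    proof
      assume ?l
      then obtain c where c: "consistent c L" "length c = length (u @ y # v)"
        "generates dq xs (zip (u @ y # v) c) (y # q)" by blast
      show ?r using c generates_Cons_open[OF open_elem(1) _ c(2), of dq q] Cons.prems os by auto
    next
      assume ?r
      then obtain cu cx cv where c: "length cu = length u" "length cv = length v"
        "consistent (cu @ cx # cv) L"
        "(\<forall>e\<in>set cu. e \<noteq> cx) \<or> dq \<and> cv = [] \<and> (\<exists>e. \<forall>z\<in>set cu. z = e)"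
        "generates dq xs (zip (u @ v) (cu @ cv)) q" by blast
      have len: "length (cu @ cx # cv) = length (u @ y # v)" using c by simp
      have "distinct (u @ y # v)" using Cons.prems os by simp
      from generates_Cons_open[OF open_elem(1) this len, of dq q] c
      have "generates dq xs (zip (u @ y # v) (cu @ cx # cv)) (y # q)" by blast
      then show ?l using c(3) len by blast
    qed
    \<comment> \<open>The remaining run does not mention \<open>cx\<close>, so the quantifier over
      \<open>cx\<close> can be narrowed to the part that \<open>close_consistent\<close>
      handles.\<close>
    also have "\<dots> \<longleftrightarrow> (\<exists>cu cv. length cu = length u \<and> length cv = length v \<and>
        (\<exists>cx. consistent (cu @ cx # cv) L \<and>
          ((\<forall>e\<in>set cu. e \<noteq> cx) \<or> dq \<and> cv = [] \<and> (\<exists>e. \<forall>z\<in>set cu. z = e))) \<and>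
        generates dq xs (zip (u @ v) (cu @ cv)) q)"
      by blast
    also have "\<dots> \<longleftrightarrow> (\<exists>cu cv. length cu = length u \<and> length cv = length v \<and>
        (\<exists>L'. close dq (length u) L = Some L' \<and> consistent (cu @ cv) L') \<and>
        generates dq xs (zip (u @ v) (cu @ cv)) q)"
      by (rule ex_cong1, rule ex_cong1, rule conj_cong[OF refl], rule conj_cong[OF refl],
          rule conj_cong[OF _ refl], rule close_consistent[OF len])
    also have "\<dots> \<longleftrightarrow> (\<exists>L'. close dq (length u) L = Some L' \<and>
        (\<exists>c. consistent c L' \<and> generates dq xs (zip (u @ v) c) q))" (is "?l \<longleftrightarrow> ?r")
    proof
      assume ?r
      then obtain L' c where *: "close dq (length u) L = Some L'" "consistent c L'"
        "generates dq xs (zip (u @ v) c) q" by blast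
      have "length c = length u + length v"
        using consistent_length[OF *(2)] length_close[OF *(1)] len by simp
      then have "c = take (length u) c @ drop (length u) c" "length (take (length u) c) = length u"
        "length (drop (length u) c) = length v" by auto
      with * show ?l by metis
    qed blast
    also have "\<dots> \<longleftrightarrow> (\<exists>L'. close dq (length u) L = Some L' \<and> accepts dq xs (u @ v) L' q)"
    proof -
      have "accepts dq xs (u @ v) L' q \<longleftrightarrow> (\<exists>c. consistent c L' \<and> generates dq xs (zip (u @ v) c) q)"
        if "close dq (length u) L = Some L'" for L'
        using length_close[OF that] len Cons.prems os by (intro Cons.IH) auto
      then show ?thesis by blast
    qed
    also have "\<dots> \<longleftrightarrow> accepts dq xs os L (y # q)"
      using accepts_Cons_open[OF os(2) open_elem(1)] os(1) by blast
    finally show ?thesis by simp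
  next
    case none
    have "\<not> generates dq xs (zip os c) (y # q)" for c
      using generates_pop_first[of dq xs "zip os c" y q] none
      by (metis in_set_conv_decomp set_zip_leftD)
    then show ?thesis using none by auto
  qed
qed

section \<open>Counting accepted sequences by states alone\<close>

definition successors :: "bool \<Rightarrow> nat \<Rightarrow> link list \<Rightarrow> link list list" where
  "successors dq k L =
     map (\<lambda>e. replicate e Free @ L) [0..<k - length L] @
     List.map_filter (\<lambda>d. close dq d L) [0..<length L]"

text \<open>Here \<open>k\<close> is the number of outputs to come, so \<open>k - length L\<close>
  elements are still unread. The names of the elements are gone, which is what makes dynamic
  programming possible.\<close>

fun ways :: "bool \<Rightarrow> nat \<Rightarrow> link list \<Rightarrow> nat" where
  "ways dq 0 L = 1"
| "ways dq (Suc k) L = (\<Sum>L'\<leftarrow>successors dq (Suc k) L. ways dq k L')"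

lemma sum_list_map_filter_option:
  "(\<Sum>y\<leftarrow>List.map_filter f xs. g y) = (\<Sum>x\<leftarrow>xs. case f x of None \<Rightarrow> 0 | Some y \<Rightarrow> g y)"
  for g :: "'b \<Rightarrow> nat"
  by (induction xs) (auto simp: map_filter_simps split: option.splits)

lemma sum_list_map_nth: "(\<Sum>x\<leftarrow>xs. f x) = (\<Sum>i\<leftarrow>[0..<length xs]. f (xs ! i))"
  by (subst map_nth[of xs, symmetric]) (simp only: map_map o_def)

declare accepts.simps(2) [simp del]

text \<open>The accepted sequences are partitioned by their first output, addressed by its position
  in the input or among the open elements. Each class is in bijection with the sequences accepted
  after one transition, so the names of the elements do not influence the count.\<close>

lemma finite_card_accepts:
  assumes "distinct (xs @ os)" "length os = length L" "length xs + length os = k"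
  shows "finite {q. accepts dq xs os L q} \<and> card {q. accepts dq xs os L q} = ways dq k L"
  using assms
proof (induction k arbitrary: xs os L)
  case 0
  have "accepts dq [] [] L q \<longleftrightarrow> q = []" for q :: "'a list" by (cases q) (auto simp: accepts.simps(2))
  then show ?case using 0 by simp
next
  case (Suc k)
  let ?B = "\<lambda>y. {q. accepts dq xs os L (y # q)}"
  have input: "finite (?B (xs ! e)) \<and> card (?B (xs ! e)) = ways dq k (replicate e Free @ L)"
    if "e < length xs" for e
  proof -
    have xs: "xs = take e xs @ xs ! e # drop (Suc e) xs" using that by (rule id_take_nth_drop)
    have *: "distinct ((take e xs @ xs ! e # drop (Suc e) xs) @ os)" using Suc.prems(1) xs by simp
    then have "xs ! e \<notin> set (take e xs)" unfolding distinct_append by auto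
    from accepts_Cons_input[OF this, of dq "drop (Suc e) xs" os L, folded xs] that
    have "?B (xs ! e) = {q. accepts dq (drop (Suc e) xs) (rev (take e xs) @ os)
        (replicate e Free @ L) q}"
      by simp
    then show ?thesis
      using Suc.IH[of "drop (Suc e) xs" "rev (take e xs) @ os" "replicate e Free @ L"] Suc.prems * that
      by auto
  qed
  have opened: "finite (?B (os ! d)) \<and>
      card (?B (os ! d)) = (case close dq d L of None \<Rightarrow> 0 | Some L' \<Rightarrow> ways dq k L')"
    if "d < length os" for d
  proof -
    have os: "os = take d os @ os ! d # drop (Suc d) os" using that by (rule id_take_nth_drop)
    have *: "distinct (xs @ take d os @ os ! d # drop (Suc d) os)" using Suc.prems(1) os by simp
    then have "os ! d \<notin> set (take d os)" "os ! d \<notin> set xs" unfolding distinct_append by auto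
    from accepts_Cons_open[OF this, of dq "drop (Suc d) os" L, folded os] that
    have B: "?B (os ! d) = {q. \<exists>L'. close dq d L = Some L' \<and>
        accepts dq xs (take d os @ drop (Suc d) os) L' q}"
      by simp
    show ?thesis
    proof (cases "close dq d L")
      case None
      then show ?thesis unfolding B by simp
    next
      case (Some L')
      then show ?thesis
        using Suc.IH[of xs "take d os @ drop (Suc d) os" L'] length_close[OF Some] Suc.prems * that
        unfolding B by auto
    qed
  qed
  have fin: "finite (?B y)" if "y \<in> set xs \<union> set os" for y
    using that input opened by (auto simp: in_set_conv_nth)
  have none: "\<not> accepts dq xs os L (y # q)" if "y \<notin> set xs \<union> set os" for y q
    using that by (simp add: accepts.simps(2))
  have "{q. accepts dq xs os L q} = (\<Union>y\<in>set xs \<union> set os. Cons y ` ?B y)" (is "?l = ?r")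
  proof (rule set_eqI)
    fix q
    show "q \<in> ?l \<longleftrightarrow> q \<in> ?r"
    proof (cases q)
      case Nil
      then show ?thesis using Suc.prems by auto
    next
      case (Cons y q')
      then show ?thesis using none[of y q'] by auto
    qed
  qed
  moreover have "card (\<Union>y\<in>set xs \<union> set os. Cons y ` ?B y) = ways dq (Suc k) L"
  proof -
    have "card (\<Union>y\<in>set xs \<union> set os. Cons y ` ?B y) = (\<Sum>y\<in>set xs \<union> set os. card (Cons y ` ?B y))"
      using fin by (intro card_UN_disjoint) auto
    also have "\<dots> = (\<Sum>y\<in>set (xs @ os). card (?B y))"
      by (simp add: card_image)
    also have "\<dots> = (\<Sum>y\<leftarrow>xs @ os. card (?B y))"
      using Suc.prems(1) by (simp only: sum_list_distinct_conv_sum_set)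
    also have "\<dots> = (\<Sum>e\<leftarrow>[0..<length xs]. card (?B (xs ! e))) + (\<Sum>d\<leftarrow>[0..<length os]. card (?B (os ! d)))"
      unfolding map_append sum_list_append
      using sum_list_map_nth[of "\<lambda>y. card (?B y)" xs] sum_list_map_nth[of "\<lambda>y. card (?B y)" os] by argo
    also have "(\<Sum>e\<leftarrow>[0..<length xs]. card (?B (xs ! e))) = (\<Sum>e\<leftarrow>[0..<length xs]. ways dq k (replicate e Free @ L))"
      using input by (intro arg_cong[where f = sum_list] map_cong) auto
    also have "(\<Sum>d\<leftarrow>[0..<length os]. card (?B (os ! d))) =
        (\<Sum>d\<leftarrow>[0..<length os]. case close dq d L of None \<Rightarrow> 0 | Some L' \<Rightarrow> ways dq k L')"
      using opened by (intro arg_cong[where f = sum_list] map_cong) auto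
    finally show ?thesis
      using Suc.prems(2) diff_add_inverse2[of "length xs" "length os", unfolded Suc.prems(3)]
      by (simp add: successors_def sum_list_map_filter_option o_def)
  qed
  ultimately show ?case using fin by simp
qed

lemma generates_mset: "generates dq xs s q \<Longrightarrow> mset q = mset xs + mset (map fst s)"
  by (induction rule: generates.induct) auto

lemma card_generates: "card {p \<in> permutations_of_set {1..n}. generates dq p [] [1..<Suc n]} = ways dq n []"
proof -
  have gen: "generates dq [1..<Suc n] [] q \<longleftrightarrow> accepts dq [1..<Suc n] [] [] q" for q
    using accepts_iff_generates[of "[1..<Suc n]" "[]" "[]" dq q] consistent_length[of _ "[]"]
    by (auto simp del: upt_Suc intro!: exI[of _ "[]"])
  have "{q \<in> permutations_of_set {1..n}. generates dq [1..<Suc n] [] q} =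
    {q. accepts dq [1..<Suc n] [] [] q}"
  proof -
    have "q \<in> permutations_of_set {1..n}" if "generates dq [1..<Suc n] [] q" for q
    proof -
      have q: "mset q = mset [1..<Suc n]" using generates_mset[OF that] by simp
      have "set [1..<Suc n] = {1..n}" by auto
      then show ?thesis
        using mset_eq_setD[OF q] mset_eq_imp_distinct_iff[OF q] by (intro permutations_of_setI) simp_all
    qed
    then show ?thesis using gen by blast
  qed
  then show ?thesis
    unfolding card_generates_inverse
    using finite_card_accepts[of "[1..<Suc n]" "[]" "[]" n dq] by simp
qed

lemma card_sortable_perms:
  "card (stacks_sortable_perms n) = ways False n []"
  "card (deque_sortable_perms n) = ways True n []"
proof -
  have len: "length p = n" if "p \<in> permutations_of_set {1..n}" for p :: "nat list"
    using length_finite_permutations_of_set[OF that] by simp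
  have "stacks_sortable_perms n = {p \<in> permutations_of_set {1..n}. generates False p [] [1..<Suc n]}"
    unfolding stacks_sortable_perms_def stacks_sortable_iff using len by auto
  then show "card (stacks_sortable_perms n) = ways False n []" by (simp only: card_generates)
  have "deque_sortable_perms n = {p \<in> permutations_of_set {1..n}. generates True p [] [1..<Suc n]}"
    unfolding deque_sortable_perms_def deque_sortable_iff using len by auto
  then show "card (deque_sortable_perms n) = ways True n []" by (simp only: card_generates)
qed

section \<open>The number of reachable states\<close>

fun top_linked :: "link list \<Rightarrow> nat" where
  "top_linked [] = 0"
| "top_linked (x # L) = (if x = Free then 0 else 1)"

text \<open>
  A group is a \<open>Diff\<close> together with the \<open>Same\<close> links above it, or a maximal run of \<open>Same\<close>
  links that is not on top of a \<open>Diff\<close>. A new group can only be created by outputting an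
  element that is not the youngest one; a second output of this kind absorbs the group on top
  unless another output intervenes. Hence two outputs are needed for each group.
\<close>

fun groups :: "link list \<Rightarrow> nat" where
  "groups [] = 0"
| "groups (Free # L) = groups L"
| "groups (Diff # L) = Suc (groups L)"
| "groups (Same # L) = groups L + (1 - top_linked L)"

text \<open>With \<open>n - k\<close> outputs made, two are charged for each group, but one of these
  charges may still be outstanding while the top link is not \<open>Free\<close>. Combined with
  \<open>length L \<le> k\<close> this gives \<open>length L + 2 * groups L \<le> n + 1\<close> for
  every \<open>k\<close>.\<close>

definition admissible :: "nat \<Rightarrow> nat \<Rightarrow> link list \<Rightarrow> bool" where
  "admissible n k L \<longleftrightarrow> length L \<le> k \<and> 2 * groups L + k \<le> n + top_linked L"

lemma top_linked_le: "top_linked L \<le> 1"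
  by (cases L) auto

lemma groups_Cons_ge: "groups L \<le> groups (x # L)"
  by (cases x) auto

lemma groups_Cons_le: "groups (x # L) \<le> Suc (groups L)"
  by (cases x) auto

lemma groups_append_ge: "groups L \<le> groups (s @ L)"
  using groups_Cons_ge order_trans by (induction s) (auto, blast)

lemma groups_pos: "top_linked L = 1 \<Longrightarrow> 0 < groups L"
proof (induction L)
  case (Cons x L)
  then show ?case using top_linked_le[of L] by (cases x) (auto simp: le_Suc_eq)
qed simp

text \<open>As \<open>s\<close> does not end in \<open>Same\<close>, no group of \<open>s\<close>
  extends into \<open>L\<close>; a linked top then witnesses a group inside
  \<open>s\<close>.\<close>

lemma groups_append_linked:
  "top_linked (s @ L) = 1 \<Longrightarrow> s \<noteq> [] \<Longrightarrow> last s \<noteq> Same \<Longrightarrow> Suc (groups L) \<le> groups (s @ L)"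
proof (induction s)
  case (Cons y s)
  show ?case
  proof (cases "s = []")
    case True
    then show ?thesis using Cons.prems by (cases y) auto
  next
    case False
    then show ?thesis
      using Cons groups_append_ge[of L s] top_linked_le[of "s @ L"] by (cases y) (auto simp: le_Suc_eq)
  qed
qed simp

lemma groups_replicate_Free [simp]: "groups (replicate e Free @ L) = groups L"
  by (induction e) auto

lemma groups_replicate_Same:
  "groups (replicate (Suc d) Same @ L) = groups L + (1 - top_linked L)"
  by (induction d) auto

lemma groups_Same_flip: "groups (replicate d Same @ flip x # r) \<le> Suc (groups r)"
proof (cases d)
  case 0
  then show ?thesis by (simp add: groups_Cons_le)
next
  case (Suc d')
  then show ?thesis by (simp only: groups_replicate_Same) (cases x, auto)
qed

lemma groups_Same_flip_Cons:
  "groups (replicate d Same @ flip x # r) \<le> groups (x # r) + (if x = Free \<and> d = 0 then 0 else 1)"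
  using groups_Same_flip[of d x r] groups_Cons_ge[of r x] by auto

text \<open>Each output supplies one unit for the charge. A removal below an unlinked top may create
  a group, paying one unit and borrowing the other through \<open>top_linked\<close>. From a linked
  top the debt is settled by this output: a push or a removal of the youngest element creates no
  group, and a deeper removal absorbs the group on top.\<close>

lemma admissible_successor:
  assumes adm: "admissible n (Suc k) L" and L': "L' \<in> set (successors dq (Suc k) L)"
  shows "admissible n k L'"
proof -
  have push: "admissible n k (replicate e Free @ L)" if "e < Suc k - length L" for e
    using adm that top_linked_le[of L] by (cases e) (auto simp: admissible_def)
  have close: "admissible n k L'" if cl: "close dq d L = Some L'" for d
  proof -
    have len: "length L' \<le> k" using length_close[OF cl] adm by (simp add: admissible_def)
    from cl obtain x r where d: "drop d L = x # r" by (cases "drop d L") (auto simp: close_def)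
    show ?thesis
    proof (cases d)
      case 0
      then have L: "L = x # L'" using cl d by (auto simp: close_def)
      then show ?thesis
        using adm len by (cases x; cases L') (auto simp: admissible_def split: if_splits)
    next
      case (Suc d')
      define s where "s = take d L"
      have L: "L = s @ x # r" using append_take_drop_id[of d L] d by (simp add: s_def)
      have s: "length s = Suc d'" using arg_cong[OF L, of length] arg_cong[OF d, of length] Suc
        by (simp add: s_def)
      have L': "L' = replicate d' Same @ flip x # r"
        using cl Suc d by (auto simp: close_def split: if_splits)
      have gL: "groups (x # r) \<le> groups L" unfolding L by (rule groups_append_ge)
      have free: "flip x = Free \<longleftrightarrow> x = Free" by (cases x) auto
      have flag: "top_linked L' = (if x = Free \<and> d' = 0 then 0 else 1)"
        unfolding L' by (cases d') (auto simp: free)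
      show ?thesis
      proof (cases "top_linked L = 0")
        case True
        then show ?thesis
          using adm len gL groups_Same_flip_Cons[of d' x r] flag
          by (auto simp: admissible_def L' split: if_splits)
      next
        case False
        then have top: "top_linked L = 1" using top_linked_le[of L] by simp
        have s_ne: "s \<noteq> []" using s by auto
        \<comment> \<open>The guard of \<open>close\<close> ensures that the top group ends above
          the removed element, or that nothing older remains. Either way this group disappears,
          which compensates for the one that the removal may create.\<close>
        have "last s \<noteq> Same \<or> r = []"
        proof -
          have "last s = L ! (d - 1)" using s s_ne L Suc by (simp add: last_conv_nth nth_append)
          then show ?thesis using cl Suc d by (auto simp: close_def split: if_splits)
        qed
        then have "Suc (groups r) \<le> groups L"
        proof
          assume "last s \<noteq> Same"
          then have "Suc (groups (x # r)) \<le> groups L"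
            using groups_append_linked[of s "x # r"] top s_ne L by auto
          then show ?thesis using groups_Cons_ge[of r x] by simp
        next
          assume "r = []"
          then show ?thesis using groups_pos[OF top] by simp
        qed
        then show ?thesis
          using adm len groups_Same_flip[of d' x r] flag top
          by (cases "x = Free \<and> d' = 0") (auto simp: admissible_def L')
      qed
    qed
  qed
  from L' show ?thesis unfolding successors_def
    by (auto simp: map_filter_def push dest!: close)
qed


section \<open>A Kraft-type count of link lists\<close>

definition weight :: "link list \<Rightarrow> real" where
  "weight L = (if top_linked L = 0 then 1 else 8 / 5) * (1 / 2) ^ (length L + 2 * groups L)"

lemma finite_link_lists: "finite {L :: link list. length L = m}"
proof -
  have "finite (UNIV :: link set)"
  proof (rule finite_subset)
    show "(UNIV :: link set) \<subseteq> {Free, Same, Diff}" using link.exhaust by blast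
  qed simp
  from finite_lists_length_eq[OF this] show ?thesis by simp
qed

lemma weight_nonneg: "0 \<le> weight L"
  by (simp add: weight_def)

text \<open>With a factor \<open>a\<close> for a linked top, the ratio is \<open>1/2 + a/4\<close>
  above an unlinked top and \<open>(1/2 + a/2 + a/8) / a\<close> above a linked one. Both are below
  1 exactly for \<open>4/3 < a < 2\<close>; the choice \<open>a = 8/5\<close> gives
  \<open>9/10\<close> and \<open>15/16\<close>. A ratio bounded away from 1 makes the sum over all
  lengths a geometric series with limit 16.\<close>

lemma weight_Cons: "weight (Free # L) + weight (Same # L) + weight (Diff # L) \<le> 15 / 16 * weight L"
  using top_linked_le[of L]
  by (cases "top_linked L = 0") (auto simp: weight_def power_add)

lemma sum_weight_length: "(\<Sum>L | length L = m. weight L) \<le> (15 / 16) ^ m"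
proof (induction m)
  case 0
  have "{L :: link list. length L = 0} = {[]}" by auto
  then show ?case by (simp add: weight_def)
next
  case (Suc m)
  let ?S = "{L :: link list. length L = m}"
  have eq: "{L. length L = Suc m} = Cons Free ` ?S \<union> (Cons Same ` ?S \<union> Cons Diff ` ?S)" (is "?l = ?r")
  proof
    show "?l \<subseteq> ?r"
    proof
      fix L :: "link list" assume "L \<in> ?l"
      then obtain x L' where "L = x # L'" "length L' = m" by (auto simp: length_Suc_conv)
      then show "L \<in> ?r" by (cases x) auto
    qed
  qed auto
  have "(\<Sum>L | length L = Suc m. weight L) =
      (\<Sum>L\<in>Cons Free ` ?S. weight L) + ((\<Sum>L\<in>Cons Same ` ?S. weight L) + (\<Sum>L\<in>Cons Diff ` ?S. weight L))"
    unfolding eq using finite_link_lists[of m]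
    by (subst sum.union_disjoint; (subst sum.union_disjoint)?) auto
  also have "\<dots> = (\<Sum>L\<in>?S. weight (Free # L) + weight (Same # L) + weight (Diff # L))"
    by (simp add: sum.reindex sum.distrib)
  also have "\<dots> \<le> (\<Sum>L\<in>?S. 15 / 16 * weight L)"
    by (intro sum_mono weight_Cons)
  also have "\<dots> = 15 / 16 * (\<Sum>L\<in>?S. weight L)"
    by (simp only: sum_distrib_left)
  also have "\<dots> \<le> (15 / 16) ^ Suc m"
    using Suc.IH by simp
  finally show ?case .
qed

text \<open>
  A Kraft-type inequality: an admissible list has weight at least \<open>2\<close> to the power \<open>- (n + 1)\<close>,
  while the weights of all lists add up to at most 16.
\<close>

lemma card_admissible:
  shows "finite {L. admissible n k L}" and "card {L. admissible n k L} \<le> 32 * 2 ^ n"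
proof -
  let ?A = "{L. admissible n k L}"
  let ?U = "\<Union>m\<le>k. {L :: link list. length L = m}"
  have fin: "finite ?U" using finite_link_lists by auto
  have sub: "?A \<subseteq> ?U" by (auto simp: admissible_def)
  show finA: "finite ?A" using sub fin by (rule finite_subset)
  have "real (card ?A) * (1 / 2) ^ Suc n = (\<Sum>L\<in>?A. (1 / 2) ^ Suc n)" by simp
  also have "\<dots> \<le> (\<Sum>L\<in>?A. weight L)"
  proof (rule sum_mono)
    fix L assume "L \<in> ?A"
    then have "length L + 2 * groups L \<le> Suc n"
      using top_linked_le[of L] by (auto simp: admissible_def)
    then have "(1 / 2 :: real) ^ Suc n \<le> (1 / 2) ^ (length L + 2 * groups L)"
      by (intro power_decreasing) auto
    also have "\<dots> \<le> weight L" by (simp add: weight_def)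
    finally show "(1 / 2) ^ Suc n \<le> weight L" .
  qed
  also have "\<dots> \<le> (\<Sum>L\<in>?U. weight L)"
    using fin sub weight_nonneg by (intro sum_mono2) auto
  also have "\<dots> = (\<Sum>m\<le>k. \<Sum>L | length L = m. weight L)"
    using finite_link_lists by (intro sum.UNION_disjoint) auto
  also have "\<dots> \<le> (\<Sum>m\<le>k. (15 / 16) ^ m)"
    by (intro sum_mono sum_weight_length)
  also have "\<dots> \<le> 16"
    by (simp add: sum_gp0)
  finally have "real (card ?A) * (1 / 2) ^ Suc n \<le> 16" .
  then have "real (card ?A) \<le> real (32 * 2 ^ n)"
    by (simp add: power_divide field_simps)
  then show "card ?A \<le> 32 * 2 ^ n" by (simp only: of_nat_le_iff)
qed

section \<open>Running programs\<close>

lemma usage_upd_le: "usage (s(l \<mapsto> v)) \<le> Suc (usage s)"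
  by (simp add: usage_def card_insert_le_m1 card_insert_if)

lemma usage_delete_le: "usage (s(l := None)) \<le> usage s"
  by (cases "finite (dom s)") (auto simp: usage_def intro: card_mono)

lemma run_space_le: "run c s t m s' \<Longrightarrow> usage s' \<le> usage s + t \<and> m \<le> usage s + t"
proof (induction rule: run.induct)
  case (Assign s' s x a)
  have "usage s' \<le> Suc (usage s)" unfolding Assign by (rule usage_upd_le)
  then show ?case by simp
next
  case (Insert s' s d k a)
  have "usage s' \<le> Suc (usage s)" unfolding Insert by (rule usage_upd_le)
  then show ?case by simp
next
  case (Delete s' s d k)
  have "usage s' \<le> usage s" unfolding Delete by (rule usage_delete_le)
  then show ?case by simp
qed auto

text \<open>Exact times are relaxed to upper bounds that compose easily. Space is left out because
  \<open>run_space_le\<close> recovers it from the time.\<close>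

definition reaches :: "com \<Rightarrow> state \<Rightarrow> nat \<Rightarrow> state \<Rightarrow> bool" where
  "reaches c s T s' \<longleftrightarrow> (\<exists>t m. run c s t m s' \<and> t \<le> T)"

lemma reaches_weaken: "reaches c s T s' \<Longrightarrow> T \<le> T' \<Longrightarrow> reaches c s T' s'"
  unfolding reaches_def by (meson order_trans)

lemma reaches_Seq: "reaches c1 s T1 s1 \<Longrightarrow> reaches c2 s1 T2 s2 \<Longrightarrow> reaches (Seq c1 c2) s (T1 + T2) s2"
  unfolding reaches_def by (meson add_mono run.Seq)

lemma reaches_WhileFalse: "\<not> bval p s \<Longrightarrow> reaches (While p c) s (1 + bcost p) s"
  unfolding reaches_def by (meson order_refl run.WhileFalse)

lemma reaches_WhileTrue:
  "bval p s \<Longrightarrow> reaches c s T1 s1 \<Longrightarrow> reaches (While p c) s1 T2 s2 \<Longrightarrow>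
   reaches (While p c) s (1 + bcost p + T1 + T2) s2"
  unfolding reaches_def by (meson add_mono order_refl run.WhileTrue)

lemma reaches_CondTrue:
  "bval p s \<Longrightarrow> reaches c1 s T s' \<Longrightarrow> reaches (Cond p c1 c2) s (1 + bcost p + T) s'"
  unfolding reaches_def by (meson add_mono order_refl run.CondTrue)

lemma reaches_CondFalse:
  "\<not> bval p s \<Longrightarrow> reaches c2 s T s' \<Longrightarrow> reaches (Cond p c1 c2) s (1 + bcost p + T) s'"
  unfolding reaches_def by (meson add_mono order_refl run.CondFalse)

fun loopfree :: "com \<Rightarrow> bool" where
  "loopfree (Seq c1 c2) \<longleftrightarrow> loopfree c1 \<and> loopfree c2"
| "loopfree (Cond p c1 c2) \<longleftrightarrow> loopfree c1 \<and> loopfree c2"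
| "loopfree (While p c) \<longleftrightarrow> False"
| "loopfree _ \<longleftrightarrow> True"

text \<open>A functional semantics that simplification can unfold. The catch-all equation is right
  for \<open>Skip\<close>; for \<open>While\<close> it is a placeholder that \<open>loopfree\<close>
  excludes.\<close>

fun exec :: "com \<Rightarrow> state \<Rightarrow> state" where
  "exec (Assign x a) s = s(Reg x \<mapsto> aval a s)"
| "exec (Insert d k a) s = s(Cell d (aval k s) \<mapsto> aval a s)"
| "exec (Delete d k) s = s(Cell d (aval k s) := None)"
| "exec (Seq c1 c2) s = exec c2 (exec c1 s)"
| "exec (Cond p c1 c2) s = (if bval p s then exec c1 s else exec c2 s)"
| "exec _ s = s"

fun cost :: "com \<Rightarrow> nat" where
  "cost Skip = 1"
| "cost (Assign x a) = 1 + acost a"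
| "cost (Insert d k a) = 1 + acost k + acost a"
| "cost (Delete d k) = 1 + acost k"
| "cost (Seq c1 c2) = cost c1 + cost c2"
| "cost (Cond p c1 c2) = 1 + bcost p + max (cost c1) (cost c2)"
| "cost (While p c) = 0"

lemma reaches_exec: "loopfree c \<Longrightarrow> reaches c s (cost c) (exec c s)"
proof (induction c arbitrary: s)
  case Skip
  show ?case unfolding reaches_def using run.Skip by fastforce
next
  case (Assign x a)
  show ?case unfolding reaches_def using run.Assign by fastforce
next
  case (Insert d k a)
  show ?case unfolding reaches_def using run.Insert by fastforce
next
  case (Delete d k)
  show ?case unfolding reaches_def using run.Delete by fastforce
next
  case (Seq c1 c2)
  then show ?case using reaches_Seq[of c1 s "cost c1" "exec c1 s" c2] by simp
next
  case (Cond p c1 c2)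
  show ?case
  proof (cases "bval p s")
    case True
    with Cond have "reaches (Cond p c1 c2) s (1 + bcost p + cost c1) (exec c1 s)"
      by (intro reaches_CondTrue) simp_all
    then show ?thesis using True by (auto intro: reaches_weaken)
  next
    case False
    with Cond have "reaches (Cond p c1 c2) s (1 + bcost p + cost c2) (exec c2 s)"
      by (intro reaches_CondFalse) simp_all
    then show ?thesis using False by (auto intro: reaches_weaken)
  qed
qed simp

fun written :: "com \<Rightarrow> string set" where
  "written (Assign x a) = {x}"
| "written (Seq c1 c2) = written c1 \<union> written c2"
| "written (Cond p c1 c2) = written c1 \<union> written c2"
| "written (While p c) = written c"
| "written _ = {}"

fun dicts_written :: "com \<Rightarrow> string set" where
  "dicts_written (Insert d k a) = {d}"
| "dicts_written (Delete d k) = {d}"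
| "dicts_written (Seq c1 c2) = dicts_written c1 \<union> dicts_written c2"
| "dicts_written (Cond p c1 c2) = dicts_written c1 \<union> dicts_written c2"
| "dicts_written (While p c) = dicts_written c"
| "dicts_written _ = {}"

lemma run_unchanged:
  "run c s t m s' \<Longrightarrow>
    (x \<notin> written c \<longrightarrow> s' (Reg x) = s (Reg x)) \<and>
    (d \<notin> dicts_written c \<longrightarrow> s' (Cell d k) = s (Cell d k))"
  by (induction rule: run.induct) auto

lemma reaches_unchanged:
  assumes "reaches c s T s'"
  shows "x \<notin> written c \<Longrightarrow> s' (Reg x) = s (Reg x)"
    and "x \<notin> written c \<Longrightarrow> read s' (Reg x) = read s (Reg x)"
    and "d \<notin> dicts_written c \<Longrightarrow> s' (Cell d k) = s (Cell d k)"
  using assms run_unchanged unfolding reaches_def read_def by metis+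

lemma read_upd [simp]: "read (s(l \<mapsto> v)) l' = (if l' = l then v else read s l')"
  by (simp add: read_def)

section \<open>Layer-by-layer search\<close>

text \<open>The digits make \<open>flip\<close> the map sending a digit \<open>i\<close> to \<open>4 - i\<close>.\<close>

fun digit :: "link \<Rightarrow> int" where
  "digit Same = 1"
| "digit Free = 2"
| "digit Diff = 3"

fun code :: "link list \<Rightarrow> int" where
  "code [] = 0"
| "code (x # L) = digit x + 4 * code L"

lemma digit_bounds: "1 \<le> digit x" "digit x \<le> 3"
  by (cases x; simp)+

lemma digit_eq_iff [simp]: "digit x = digit y \<longleftrightarrow> x = y"
  by (cases x; cases y) auto

lemma digit_flip: "digit (flip x) = 4 - digit x"
  by (cases x) auto

lemma code_nonneg: "0 \<le> code L"
proof (induction L)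
  case (Cons x L)
  then show ?case using digit_bounds(1)[of x] by simp
qed simp

lemma code_Cons_div_mod: "code (x # L) div 4 = code L" "code (x # L) mod 4 = digit x"
  using digit_bounds[of x] by (cases x; simp)+

lemma code_eq_iff [simp]: "code L = code L' \<longleftrightarrow> L = L'"
proof (induction L arbitrary: L')
  case Nil
  then show ?case using code_nonneg[of "tl L'"] digit_bounds(1)[of "hd L'"] by (cases L') auto
next
  case (Cons x L)
  show ?case
  proof (cases L')
    case Nil
    then show ?thesis using code_nonneg[of L] digit_bounds(1)[of x] by auto
  next
    case (Cons y M)
    have "code (x # L) = code (y # M) \<Longrightarrow> digit x = digit y \<and> code L = code M"
      by (metis code_Cons_div_mod)
    then show ?thesis using Cons Cons.IH by auto
  qed
qed

lemma code_less: "length L \<le> k \<Longrightarrow> code L < 4 ^ k"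
proof (induction L arbitrary: k)
  case (Cons x L)
  then obtain k' where k: "k = Suc k'" "length L \<le> k'" by (cases k) auto
  then show ?case using Cons.IH[OF k(2)] digit_bounds(2)[of x] by simp
qed simp

lemma code_ge: "k < length L \<Longrightarrow> 4 ^ k \<le> code L"
proof (induction L arbitrary: k)
  case (Cons x L)
  show ?case
  proof (cases k)
    case 0
    then show ?thesis using code_nonneg[of L] digit_bounds(1)[of x] by simp
  next
    case (Suc k')
    then show ?thesis using Cons.IH[of k'] Cons.prems digit_bounds(1)[of x] by simp
  qed
qed simp

text \<open>No link has digit 0, so the size of a code reveals the length of the list. A single
  comparison with \<open>4 ^ k\<close> thus tests whether a state fits into layer
  \<open>k\<close>.\<close>

lemma code_less_iff: "code L < 4 ^ k \<longleftrightarrow> length L \<le> k"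
  using code_less code_ge by (meson leD linorder_not_less)

text \<open>The digits of \<open>d\<close> links \<open>Same\<close> sum to
  \<open>1 + 4 + \<dots> + 4 ^ (d - 1) = (4 ^ d - 1) / 3\<close>, which is
  \<open>4 ^ d div 3\<close> because \<open>4 ^ d\<close> leaves remainder 1.\<close>

lemma code_replicate_Same: "code (replicate d Same @ L) = 4 ^ d div 3 + 4 ^ d * code L"
proof (induction d)
  case (Suc d)
  have "(4 :: int) ^ d mod 3 = 1"
    using power_mod[of "4 :: int" 3 d] by simp
  then have "4 * (4 :: int) ^ d div 3 = 1 + 4 * (4 ^ d div 3)" by presburger
  then show ?case using Suc.IH by (simp add: algebra_simps)
qed simp

text \<open>One formula serves every depth: for \<open>d = 0\<close> the quotient
  \<open>4 ^ d div 4\<close> is 0, which cancels the run of \<open>Same\<close> and the flipped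
  link.\<close>

lemma code_close:
  assumes "drop d L = x # r" "close dq d L = Some L'"
  shows "code L' = code (x # r) div 4 * 4 ^ d + 4 ^ d div 4 div 3 + (4 - code (x # r) mod 4) * (4 ^ d div 4)"
proof (cases d)
  case 0
  then show ?thesis using assms by (simp add: close_def code_Cons_div_mod del: code.simps)
next
  case (Suc d')
  then have "L' = replicate d' Same @ flip x # r"
    using assms by (auto simp: close_def split: if_splits)
  then show ?thesis unfolding code_Cons_div_mod
    by (simp add: code_replicate_Same Suc digit_flip algebra_simps)
qed

section \<open>The layer computation on abstract tables\<close>

definition tally :: "nat \<Rightarrow> link list \<Rightarrow> link list list \<times> (link list \<Rightarrow> nat) \<Rightarrow>
    link list list \<times> (link list \<Rightarrow> nat)" where
  "tally v L = (\<lambda>(ys, f). (if L \<in> set ys then ys else ys @ [L], f(L := f L + v)))"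

definition expand :: "bool \<Rightarrow> nat \<Rightarrow> (link list \<Rightarrow> nat) \<Rightarrow> link list \<Rightarrow>
    link list list \<times> (link list \<Rightarrow> nat) \<Rightarrow> link list list \<times> (link list \<Rightarrow> nat)" where
  "expand dq k g L = fold (tally (g L)) (successors dq (Suc k) L)"

definition table_ok :: "link list list \<times> (link list \<Rightarrow> nat) \<Rightarrow> bool" where
  "table_ok = (\<lambda>(ys, f). distinct ys \<and> (\<forall>L. L \<notin> set ys \<longrightarrow> f L = 0))"

text \<open>With \<open>W = ways dq k\<close> this is the invariant of the search: count the paths
  into each state of layer \<open>k\<close>, multiply by the number of completions, and add up. It
  starts as \<open>ways dq n []\<close> and ends as the entry for \<open>[]\<close> in layer
  0.\<close>

definition weighted_total :: "(link list \<Rightarrow> nat) \<Rightarrow> link list list \<times> (link list \<Rightarrow> nat) \<Rightarrow> nat" where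
  "weighted_total W = (\<lambda>(ys, f). \<Sum>L\<in>set ys. f L * W L)"

lemma tally_properties:
  assumes "table_ok a"
  shows "table_ok (tally v L a)" "weighted_total W (tally v L a) = weighted_total W a + v * W L"
    "set (fst (tally v L a)) = insert L (set (fst a))"
proof -
  obtain ys f where a: "a = (ys, f)" by force
  show "table_ok (tally v L a)" "set (fst (tally v L a)) = insert L (set (fst a))"
    using assms by (auto simp: a tally_def table_ok_def)
  show "weighted_total W (tally v L a) = weighted_total W a + v * W L"
  proof (cases "L \<in> set ys")
    case True
    then have "(\<Sum>M\<in>set ys. (f(L := f L + v)) M * W M) =
        (f L + v) * W L + (\<Sum>M\<in>set ys - {L}. (f(L := f L + v)) M * W M)"
      by (subst sum.remove[of _ L]) auto
    also have "(\<Sum>M\<in>set ys - {L}. (f(L := f L + v)) M * W M) = (\<Sum>M\<in>set ys - {L}. f M * W M)"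
      by (intro sum.cong) auto
    also have "(f L + v) * W L + \<dots> = (\<Sum>M\<in>set ys. f M * W M) + v * W L"
      using True by (subst (2) sum.remove[of _ L]) (auto simp: algebra_simps)
    finally show ?thesis using True by (simp add: a tally_def weighted_total_def)
  next
    case False
    then have "(\<Sum>M\<in>set ys. (f(L := v)) M * W M) = (\<Sum>M\<in>set ys. f M * W M)"
      by (intro sum.cong) auto
    then show ?thesis using False assms by (simp add: a tally_def weighted_total_def table_ok_def)
  qed
qed

lemma fold_tally_properties:
  assumes "table_ok a"
  shows "table_ok (fold (tally v) Ls a)"
    "weighted_total W (fold (tally v) Ls a) = weighted_total W a + v * (\<Sum>L\<leftarrow>Ls. W L)"
    "set (fst (fold (tally v) Ls a)) = set (fst a) \<union> set Ls"
  using assms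
proof (induction Ls arbitrary: a)
  case (Cons L Ls)
  {
    case 1
    then show ?case using Cons.IH(1) tally_properties by simp
  next
    case 2
    then show ?case using Cons.IH(2) tally_properties[OF 2] by (simp add: algebra_simps)
  next
    case 3
    then show ?case using Cons.IH(3) tally_properties[OF 3] by auto
  }
qed auto

text \<open>Every state passes its count to all its successors, and \<open>ways dq (Suc k) L\<close>
  is the sum of \<open>ways dq k\<close> over these; so the weighted total is carried from one layer
  to the next.\<close>

lemma fold_expand_properties:
  assumes "table_ok a"
  shows "table_ok (fold (expand dq k g) xs a)"
    "weighted_total (ways dq k) (fold (expand dq k g) xs a) = weighted_total (ways dq k) a + (\<Sum>L\<leftarrow>xs. g L * ways dq (Suc k) L)"
    "set (fst (fold (expand dq k g) xs a)) = set (fst a) \<union> (\<Union>L\<in>set xs. set (successors dq (Suc k) L))"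
  using assms
proof (induction xs arbitrary: a)
  case (Cons L xs)
  {
    case 1
    then show ?case using Cons.IH(1) fold_tally_properties by (simp add: expand_def)
  next
    case 2
    then show ?case using Cons.IH(2) fold_tally_properties[OF 2] by (simp add: expand_def)
  next
    case 3
    then show ?case using Cons.IH(3) fold_tally_properties[OF 3] by (auto simp: expand_def)
  }
qed auto

definition emit :: "string \<Rightarrow> string \<Rightarrow> com" where
  "emit V Q =
     Seq (Cond (Member V (Plus (Var ''m'') (Var ''x''))) Skip
           (Seq (Insert Q (Var ''e'') (Var ''x'')) (Assign ''e'' (Plus (Var ''e'') (Const 1)))))
         (Insert V (Plus (Var ''m'') (Var ''x''))
           (Plus (Lookup V (Plus (Var ''m'') (Var ''x''))) (Var ''v'')))"

definition push_loop :: "string \<Rightarrow> string \<Rightarrow> com" where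
  "push_loop V Q =
     While (Less (Var ''u'') (Var ''m''))
       (Seq (Assign ''x'' (Var ''u''))
         (Seq (emit V Q) (Assign ''u'' (Plus (Times (Const 4) (Var ''u'')) (Const 2)))))"

text \<open>Register \<open>z\<close> holds the digit of the link just above the element to be
  removed, and \<open>w\<close> the code from that element downwards, so \<open>w div 4 = 0\<close>
  means that it is the oldest. \<open>Equal (Const 0) (Const 0)\<close> encodes truth.\<close>

definition close_guard :: "bool \<Rightarrow> bexp" where
  "close_guard dq =
     Neg (Conj (Equal (Var ''z'') (Const 1))
       (if dq then Neg (Equal (Div (Var ''w'') (Const 4)) (Const 0)) else Equal (Const 0) (Const 0)))"

definition close_emit :: "string \<Rightarrow> string \<Rightarrow> com" where
  "close_emit V Q =
     Seq (Assign ''x''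
           (Plus (Plus (Times (Div (Var ''w'') (Const 4)) (Var ''p''))
                       (Div (Div (Var ''p'') (Const 4)) (Const 3)))
                 (Times (Minus (Const 4) (Mod (Var ''w'') (Const 4))) (Div (Var ''p'') (Const 4)))))
       (emit V Q)"

text \<open>A \<open>Diff\<close> just above the current element still permits its removal, but
  rules out all deeper ones; setting \<open>w\<close> to 0 ends the loop.\<close>

definition close_advance :: com where
  "close_advance =
     Cond (Equal (Var ''z'') (Const 3)) (Assign ''w'' (Const 0))
       (Seq (Assign ''z'' (Mod (Var ''w'') (Const 4)))
         (Seq (Assign ''w'' (Div (Var ''w'') (Const 4)))
              (Assign ''p'' (Times (Const 4) (Var ''p'')))))"

definition close_loop :: "bool \<Rightarrow> string \<Rightarrow> string \<Rightarrow> com" where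
  "close_loop dq V Q =
     While (Less (Const 0) (Var ''w''))
       (Seq (Cond (close_guard dq) (close_emit V Q) Skip) close_advance)"

definition fetch :: "string \<Rightarrow> string \<Rightarrow> com" where
  "fetch V Q =
     Seq (Assign ''c'' (Lookup Q (Var ''h'')))
       (Seq (Assign ''h'' (Plus (Var ''h'') (Const 1)))
         (Seq (Assign ''v'' (Lookup V (Plus (Times (Const 4) (Var ''m'')) (Var ''c''))))
           (Assign ''u'' (Var ''c''))))"

definition start_close :: com where
  "start_close = Seq (Assign ''w'' (Var ''c'')) (Seq (Assign ''z'' (Const 2)) (Assign ''p'' (Const 1)))"

definition expand_prog :: "bool \<Rightarrow> string \<Rightarrow> string \<Rightarrow> com" where
  "expand_prog dq V Q =
     Seq (fetch V Q) (Seq (push_loop V Q) (Seq start_close (close_loop dq V Q)))"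

text \<open>Register \<open>g\<close> freezes the end of the current layer in the queue, since
  \<open>e\<close> moves on while successors are appended.\<close>

definition layer_start :: com where
  "layer_start = Seq (Assign ''m'' (Div (Var ''m'') (Const 4))) (Assign ''g'' (Var ''e''))"

definition layer_loop :: "bool \<Rightarrow> string \<Rightarrow> string \<Rightarrow> com" where
  "layer_loop dq V Q = While (Less (Var ''h'') (Var ''g'')) (expand_prog dq V Q)"

definition layers_prog :: "bool \<Rightarrow> string \<Rightarrow> string \<Rightarrow> com" where
  "layers_prog dq V Q =
     While (Less (Const 1) (Var ''m'')) (Seq layer_start (layer_loop dq V Q))"

definition power_prog :: com where
  "power_prog =
     Seq (Seq (Assign ''m'' (Const 1)) (Assign ''i'' (Const 0)))
       (While (Less (Var ''i'') (Var ''n''))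
         (Seq (Assign ''m'' (Times (Const 4) (Var ''m''))) (Assign ''i'' (Plus (Var ''i'') (Const 1)))))"

definition count_init :: "string \<Rightarrow> string \<Rightarrow> com" where
  "count_init V Q =
     Seq (Insert Q (Const 0) (Const 0))
       (Seq (Insert V (Var ''m'') (Const 1)) (Seq (Assign ''h'' (Const 0)) (Assign ''e'' (Const 1))))"

definition count_prog :: "bool \<Rightarrow> string \<Rightarrow> string \<Rightarrow> string \<Rightarrow> com" where
  "count_prog dq V Q r =
     Seq power_prog
       (Seq (count_init V Q) (Seq (layers_prog dq V Q) (Assign r (Lookup V (Const 1)))))"

lemmas prog_defs = emit_def push_loop_def close_guard_def close_emit_def close_advance_def
  close_loop_def fetch_def start_close_def expand_prog_def layer_start_def layer_loop_def
  layers_prog_def power_prog_def count_init_def count_prog_def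

text \<open>
  Layer \<open>k\<close> consists of the states with \<open>k\<close> outputs still to come. Its entry for \<open>L\<close> has the
  key \<open>4 ^ k + code L\<close> in \<open>V\<close>, so that distinct layers use disjoint ranges of keys.
\<close>

definition layer_table :: "string \<Rightarrow> nat \<Rightarrow> (link list \<Rightarrow> nat) \<Rightarrow> state \<Rightarrow> bool" where
  "layer_table V k f s \<longleftrightarrow>
     (\<forall>L. length L \<le> k \<longrightarrow> read s (Cell V (4 ^ k + code L)) = int (f L))"

definition queue :: "string \<Rightarrow> link list list \<Rightarrow> state \<Rightarrow> bool" where
  "queue Q qs s \<longleftrightarrow> read s (Reg ''e'') = int (length qs) \<and>
     (\<forall>i<length qs. read s (Cell Q (int i)) = code (qs ! i))"

definition fresh :: "string \<Rightarrow> int \<Rightarrow> state \<Rightarrow> bool" where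
  "fresh V b s \<longleftrightarrow> (\<forall>j<b. s (Cell V j) = None)"

definition building :: "string \<Rightarrow> string \<Rightarrow> nat \<Rightarrow> link list list \<Rightarrow> (link list \<Rightarrow> nat) \<Rightarrow>
    link list list \<times> (link list \<Rightarrow> nat) \<Rightarrow> state \<Rightarrow> bool" where
  "building V Q k qs g a s \<longleftrightarrow>
     read s (Reg ''m'') = 4 ^ k \<and> queue Q (qs @ fst a) s \<and>
     layer_table V (Suc k) g s \<and> layer_table V k (snd a) s \<and>
     (\<forall>L. length L \<le> k \<longrightarrow> (s (Cell V (4 ^ k + code L)) \<noteq> None \<longleftrightarrow> L \<in> set (fst a))) \<and>
     fresh V (4 ^ k) s"

section \<open>Correctness and running time of the program\<close>

lemma key_neq: "length L \<le> k \<Longrightarrow> (4 :: int) ^ Suc k + code M \<noteq> 4 ^ k + code L"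
proof
  assume "length L \<le> k" and eq: "(4 :: int) ^ Suc k + code M = 4 ^ k + code L"
  then have "code L < 4 ^ k" by (intro code_less)
  moreover have "(0 :: int) < 4 ^ k" by simp
  ultimately show False using eq code_nonneg[of M] unfolding power_Suc by linarith
qed

lemma building_cong:
  assumes "building V Q k qs g a s" "\<And>y. y \<in> {''m'', ''e''} \<Longrightarrow> s' (Reg y) = s (Reg y)"
    "\<And>d j. s' (Cell d j) = s (Cell d j)"
  shows "building V Q k qs g a s'"
proof -
  have "read s' (Cell d j) = read s (Cell d j)" for d j using assms(3) by (simp add: read_def)
  moreover have "read s' (Reg y) = read s (Reg y)" if "y \<in> {''m'', ''e''}" for y
    using assms(2)[OF that] by (simp add: read_def)
  ultimately show ?thesis
    using assms(1,3) by (simp add: building_def queue_def layer_table_def fresh_def)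
qed

context
  fixes V Q :: string
  assumes VQ: "V \<noteq> Q"
begin

lemma emit_correct:
  assumes b: "building V Q k qs g a s" and x: "read s (Reg ''x'') = code L" and L: "length L \<le> k"
    and v: "read s (Reg ''v'') = int v"
  shows "\<exists>s'. reaches (emit V Q) s 40 s' \<and> building V Q k qs g (tally v L a) s'"
proof -
  obtain ys f where a: "a = (ys, f)" by force
  let ?key = "4 ^ k + code L"
  define s' where "s' = exec (emit V Q) s"
  have m: "read s (Reg ''m'') = 4 ^ k" and e: "read s (Reg ''e'') = int (length (qs @ ys))"
    and q: "\<And>i. i < length (qs @ ys) \<Longrightarrow> read s (Cell Q (int i)) = code ((qs @ ys) ! i)"
    and g: "\<And>M. length M \<le> Suc k \<Longrightarrow> read s (Cell V (4 ^ Suc k + code M)) = int (g M)"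
    and f: "\<And>M. length M \<le> k \<Longrightarrow> read s (Cell V (4 ^ k + code M)) = int (f M)"
    and d: "\<And>M. length M \<le> k \<Longrightarrow> s (Cell V (4 ^ k + code M)) \<noteq> None \<longleftrightarrow> M \<in> set ys"
    and fr: "\<And>j. j < 4 ^ k \<Longrightarrow> s (Cell V j) = None"
    using b by (auto simp: building_def a queue_def layer_table_def fresh_def)
  define s1 where "s1 = (if L \<in> set ys then s
    else s(Cell Q (int (length (qs @ ys))) \<mapsto> code L, Reg ''e'' \<mapsto> int (length (qs @ ys)) + 1))"
  have s': "s' = s1(Cell V ?key \<mapsto> int (f L + v))"
    using d[OF L] VQ by (simp add: s'_def s1_def emit_def m x e v f[OF L] dom_def)
  have cells: "s1 (Cell V j) = s (Cell V j)" "read s1 (Cell V j) = read s (Cell V j)" for j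
    using VQ by (auto simp: s1_def)
  have queue: "queue Q (qs @ fst (tally v L a)) s'"
  proof (cases "L \<in> set ys")
    case True
    then show ?thesis using e q VQ by (simp add: queue_def tally_def a s' s1_def)
  next
    case False
    have "read s' (Cell Q (int i)) = code ((qs @ ys @ [L]) ! i)" if "i < Suc (length (qs @ ys))" for i
    proof (cases "i = length (qs @ ys)")
      case True
      then show ?thesis using False VQ by (simp add: s' s1_def nth_append)
    next
      case neq: False
      then have "i < length (qs @ ys)" using that by simp
      moreover from this have "(qs @ ys @ [L]) ! i = (qs @ ys) ! i"
        using nth_append[of "qs @ ys" "[L]" i] by (simp only: append_assoc if_True)
      ultimately show ?thesis using False VQ q[of i] neq by (simp add: s' s1_def)
    qed
    then show ?thesis using False by (simp add: queue_def tally_def a s' s1_def)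
  qed
  have m': "read s' (Reg ''m'') = 4 ^ k" using m by (simp add: s' s1_def)
  have g': "layer_table V (Suc k) g s'"
    using g key_neq[OF L] by (simp add: layer_table_def s' cells del: power_Suc)
  have f': "layer_table V k (snd (tally v L a)) s'"
    using f by (simp add: layer_table_def tally_def a s' cells)
  have d': "s' (Cell V (4 ^ k + code M)) \<noteq> None \<longleftrightarrow> M \<in> set (fst (tally v L a))"
    if "length M \<le> k" for M
    using d[OF that] by (auto simp: tally_def a s' cells)
  have fr': "fresh V (4 ^ k) s'"
    using fr code_nonneg[of L] by (auto simp: fresh_def s' cells)
  have "reaches (emit V Q) s 40 s'"
    unfolding s'_def by (rule reaches_weaken[OF reaches_exec]) (simp_all add: emit_def)
  moreover have "building V Q k qs g (tally v L a) s'"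
    using queue m' g' f' d' fr' by (simp add: building_def)
  ultimately show ?thesis by blast
qed

text \<open>Prepending \<open>Free\<close> maps a code \<open>u\<close> to \<open>4 * u + 2\<close>,
  and by \<open>code_less_iff\<close> the guard \<open>u < m\<close> holds exactly as long as the
  list has length at most \<open>k\<close>.\<close>

lemma push_loop_correct:
  assumes "building V Q k qs g a s" "read s (Reg ''u'') = code L" "read s (Reg ''v'') = int v"
    "length L \<le> Suc k"
  shows "\<exists>s'. reaches (push_loop V Q) s (60 * (Suc k - length L) + 4) s' \<and>
    building V Q k qs g (fold (tally v) (map (\<lambda>e. replicate e Free @ L) [0..<Suc k - length L]) a) s'"
  using assms
proof (induction "Suc k - length L" arbitrary: s a L)
  case 0
  then have "\<not> length L \<le> k" by simp
  then have "\<not> bval (Less (Var ''u'') (Var ''m'')) s"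
    using 0 code_less_iff[of L k] by (simp add: building_def)
  then have "reaches (push_loop V Q) s 4 s"
    unfolding push_loop_def by (intro reaches_weaken[OF reaches_WhileFalse]) simp_all
  then show ?case using 0 by auto
next
  case (Suc r)
  then have L: "length L \<le> k" by simp
  let ?s1 = "s(Reg ''x'' \<mapsto> code L)"
  have r1: "reaches (Assign ''x'' (Var ''u'')) s 2 ?s1"
    using reaches_exec[of "Assign ''x'' (Var ''u'')" s] Suc.prems(2) by (auto intro: reaches_weaken)
  have b1: "building V Q k qs g a ?s1"
    by (rule building_cong[OF Suc.prems(1)]) auto
  have "\<exists>s'. reaches (emit V Q) ?s1 40 s' \<and> building V Q k qs g (tally v L a) s'"
    using Suc.prems(3) by (intro emit_correct[OF b1 _ L]) simp_all
  then obtain s2 where r2: "reaches (emit V Q) ?s1 40 s2" and b2: "building V Q k qs g (tally v L a) s2"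
    by blast
  have u2: "read s2 (Reg ''u'') = code L" and v2: "read s2 (Reg ''v'') = int v"
    using reaches_unchanged(2)[OF r2] Suc.prems(2,3) by (simp_all add: emit_def)
  let ?s3 = "s2(Reg ''u'' \<mapsto> code (Free # L))"
  have r3: "reaches (Assign ''u'' (Plus (Times (Const 4) (Var ''u'')) (Const 2))) s2 6 ?s3"
    using reaches_exec[of "Assign ''u'' (Plus (Times (Const 4) (Var ''u'')) (Const 2))" s2] u2
    by (auto simp: add.commute intro: reaches_weaken)
  have b3: "building V Q k qs g (tally v L a) ?s3"
    by (rule building_cong[OF b2]) auto
  have "\<exists>s'. reaches (push_loop V Q) ?s3 (60 * (Suc k - length (Free # L)) + 4) s' \<and>
    building V Q k qs g (fold (tally v)
      (map (\<lambda>e. replicate e Free @ Free # L) [0..<Suc k - length (Free # L)]) (tally v L a)) s'"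
    using Suc.hyps(2) L v2 b3 by (intro Suc.hyps(1)) simp_all
  then obtain s4 where r4: "reaches (push_loop V Q) ?s3 (60 * (Suc k - length (Free # L)) + 4) s4"
    and b4: "building V Q k qs g (fold (tally v)
      (map (\<lambda>e. replicate e Free @ Free # L) [0..<Suc k - length (Free # L)]) (tally v L a)) s4"
    by blast
  have list: "map (\<lambda>e. replicate e Free @ L) [0..<Suc k - length L] =
      L # map (\<lambda>e. replicate e Free @ Free # L) [0..<Suc k - length (Free # L)]"
  proof -
    have "[0..<Suc k - length L] = 0 # map Suc [0..<k - length L]"
      using L by (simp add: Suc_diff_le upt_conv_Cons map_Suc_upt del: upt_Suc)
    then show ?thesis by (simp add: replicate_append_same[symmetric] o_def)
  qed
  have "bval (Less (Var ''u'') (Var ''m'')) s"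
    using Suc.prems L code_less_iff[of L k] by (simp add: building_def)
  from reaches_WhileTrue[OF this reaches_Seq[OF r1 reaches_Seq[OF r2 r3]] r4[unfolded push_loop_def]]
  have "reaches (push_loop V Q) s (60 * (Suc k - length L) + 4) s4"
    unfolding push_loop_def by (rule reaches_weaken) (use L in simp)
  then show ?case using b4 list by auto
qed

text \<open>The loop walks down the list with \<open>p = 4 ^ d\<close>. Having seen no
  \<open>Diff\<close> among the first \<open>d - 1\<close> links is an invariant, so only the last
  link \<open>z\<close> has to be tested. At \<open>d = 0\<close> no link exists, and the digit of
  \<open>Free\<close> stands in for it.\<close>

lemma close_loop_correct:
  assumes "building V Q k qs g a s" "read s (Reg ''v'') = int v" "length L \<le> Suc k" "d \<le> length L"
    "Diff \<notin> set (take (d - 1) L)" "read s (Reg ''w'') = code (drop d L)" "read s (Reg ''p'') = 4 ^ d"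
    "read s (Reg ''z'') = (if d = 0 then 2 else digit (L ! (d - 1)))"
  shows "\<exists>s'. reaches (close_loop dq V Q) s (120 * (length L - d) + 4) s' \<and>
    building V Q k qs g (fold (tally v) (List.map_filter (\<lambda>d. close dq d L) [d..<length L]) a) s'"
  using assms
proof (induction "length L - d" arbitrary: s a d)
  case 0
  then have "\<not> bval (Less (Const 0) (Var ''w'')) s" by simp
  then have "reaches (close_loop dq V Q) s 4 s"
    unfolding close_loop_def by (intro reaches_weaken[OF reaches_WhileFalse]) simp_all
  then show ?case using 0 by (auto simp: map_filter_simps)
next
  case (Suc t)
  have d: "d < length L" using Suc.hyps(2) by simp
  then obtain x r where xr: "drop d L = x # r" by (cases "drop d L") auto
  have r: "drop (Suc d) L = r" "L ! d = x"
    using xr d by (simp_all add: Cons_nth_drop_Suc[symmetric])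
  have w: "read s (Reg ''w'') = code (x # r)" using Suc.prems(6) xr by simp
  have wdiv: "code (x # r) div 4 = 0 \<longleftrightarrow> r = []"
    unfolding code_Cons_div_mod using code_eq_iff[of r "[]"] by (simp del: code_eq_iff)
  have z1: "read s (Reg ''z'') = 1 \<longleftrightarrow> d \<noteq> 0 \<and> L ! (d - 1) = Same"
    using Suc.prems(8) by (cases "L ! (d - 1)") auto
  have z3: "read s (Reg ''z'') = 3 \<longleftrightarrow> d \<noteq> 0 \<and> L ! (d - 1) = Diff"
    using Suc.prems(8) by (cases "L ! (d - 1)") auto
  have close_None: "close dq d L = None \<longleftrightarrow> \<not> bval (close_guard dq) s"
    using Suc.prems(5) xr w wdiv z1 by (auto simp: close_guard_def close_def)
  define a1 where "a1 = fold (tally v) (case close dq d L of None \<Rightarrow> [] | Some L' \<Rightarrow> [L']) a"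
  have gcost: "bcost (close_guard dq) \<le> 11" by (simp add: close_guard_def)
  have "\<exists>s1. reaches (Cond (close_guard dq) (close_emit V Q) Skip) s 80 s1 \<and> building V Q k qs g a1 s1"
  proof (cases "close dq d L")
    case None
    have "reaches (Cond (close_guard dq) (close_emit V Q) Skip) s (1 + bcost (close_guard dq) + 1) s"
      using None close_None reaches_exec[of Skip s] by (intro reaches_CondFalse) auto
    then have "reaches (Cond (close_guard dq) (close_emit V Q) Skip) s 80 s"
      using gcost by (auto intro: reaches_weaken)
    then show ?thesis using None Suc.prems(1) by (auto simp: a1_def)
  next
    case (Some L')
    let ?x = "Assign ''x''
           (Plus (Plus (Times (Div (Var ''w'') (Const 4)) (Var ''p''))
                       (Div (Div (Var ''p'') (Const 4)) (Const 3)))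
                 (Times (Minus (Const 4) (Mod (Var ''w'') (Const 4))) (Div (Var ''p'') (Const 4))))"
    let ?s = "s(Reg ''x'' \<mapsto> code L')"
    have "exec ?x s = ?s"
      using w Suc.prems(7) code_close[OF xr Some] by (simp del: code.simps)
    then have r1: "reaches ?x s 25 ?s"
      using reaches_exec[of ?x s] by (auto intro: reaches_weaken)
    have len: "length L' \<le> k" using length_close[OF Some] Suc.prems(3) by simp
    have b: "building V Q k qs g a ?s" by (rule building_cong[OF Suc.prems(1)]) auto
    have "\<exists>s1. reaches (emit V Q) ?s 40 s1 \<and> building V Q k qs g (tally v L' a) s1"
      using Suc.prems(2) by (intro emit_correct[OF b _ len]) simp_all
    then obtain s1 where r2: "reaches (emit V Q) ?s 40 s1" and b1: "building V Q k qs g (tally v L' a) s1"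
      by blast
    have "bval (close_guard dq) s" using Some close_None by simp
    then have "reaches (Cond (close_guard dq) (close_emit V Q) Skip) s 80 s1"
      unfolding close_emit_def using gcost
      by (intro reaches_weaken[OF reaches_CondTrue[OF _ reaches_Seq[OF r1 r2]]]) simp_all
    then show ?thesis using b1 Some by (auto simp: a1_def)
  qed
  then obtain s1 where r1: "reaches (Cond (close_guard dq) (close_emit V Q) Skip) s 80 s1"
    and b1: "building V Q k qs g a1 s1" by blast
  have same: "read s1 (Reg y) = read s (Reg y)" if "y \<in> {''v'', ''w'', ''p'', ''z''}" for y
    using reaches_unchanged(2)[OF r1, of y] that by (auto simp: close_emit_def emit_def)
  define s2 where "s2 = exec close_advance s1"
  have r2: "reaches close_advance s1 25 s2"
    unfolding s2_def by (rule reaches_weaken[OF reaches_exec]) (simp_all add: close_advance_def)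
  have b2: "building V Q k qs g a1 s2"
    by (rule building_cong[OF b1]) (auto simp: s2_def close_advance_def)
  have list: "fold (tally v) (List.map_filter (\<lambda>d. close dq d L) [d..<length L]) a =
      fold (tally v) (List.map_filter (\<lambda>d. close dq d L) [Suc d..<length L]) a1"
    using d by (simp add: upt_conv_Cons map_filter_simps a1_def split: option.splits)
  have "\<exists>s'. reaches (close_loop dq V Q) s2 (120 * (length L - Suc d) + 4) s' \<and>
    building V Q k qs g (fold (tally v) (List.map_filter (\<lambda>d. close dq d L) [Suc d..<length L]) a1) s'"
  proof (cases "read s (Reg ''z'') = 3")
    \<comment> \<open>The link at \<open>d - 1\<close> is \<open>Diff\<close>, hence
      \<open>close\<close> fails at every depth beyond \<open>d\<close> and leaving the loop loses
      nothing.\<close>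
    case True
    have "Diff \<in> set (take (e - 1) L)" if "Suc d \<le> e" for e
    proof -
      have "d - 1 < length (take (e - 1) L)" "take (e - 1) L ! (d - 1) = Diff"
        using that True z3 d by auto
      then show ?thesis by (metis nth_mem)
    qed
    then have "List.map_filter (\<lambda>d. close dq d L) [Suc d..<length L] = []"
      by (auto simp: map_filter_def filter_empty_conv close_def split: list.splits)
    moreover have "\<not> bval (Less (Const 0) (Var ''w'')) s2"
      using True same by (simp add: s2_def close_advance_def)
    then have "reaches (close_loop dq V Q) s2 (120 * (length L - Suc d) + 4) s2"
      unfolding close_loop_def by (intro reaches_weaken[OF reaches_WhileFalse]) simp_all
    ultimately show ?thesis using b2 by auto
  next
    case False
    have "Diff \<notin> set (take (Suc d - 1) L)"
    proof (cases d)
      case 0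
      then show ?thesis by simp
    next
      case (Suc d')
      then have "take d L = take d' L @ [L ! d']" using d by (simp add: take_Suc_conv_app_nth)
      then show ?thesis using Suc Suc.prems(5) False z3 by auto
    qed
    then show ?thesis
      using Suc.hyps(2) Suc.prems(2,3,7) d b2 r w False same
      by (intro Suc.hyps(1)) (simp_all add: s2_def close_advance_def code_Cons_div_mod del: code.simps)
  qed
  then obtain s3 where r3: "reaches (close_loop dq V Q) s2 (120 * (length L - Suc d) + 4) s3"
    and b3: "building V Q k qs g (fold (tally v) (List.map_filter (\<lambda>d. close dq d L) [Suc d..<length L]) a1) s3"
    by blast
  have "bval (Less (Const 0) (Var ''w'')) s"
    using w code_nonneg[of r] digit_bounds(1)[of x] by simp
  from reaches_WhileTrue[OF this reaches_Seq[OF r1 r2] r3[unfolded close_loop_def]]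
  have "reaches (close_loop dq V Q) s (120 * (length L - d) + 4) s3"
    unfolding close_loop_def by (rule reaches_weaken) (use d in simp)
  then show ?case using b3 list by auto
qed

lemma expand_prog_correct:
  assumes b: "building V Q k qs g a s" and h: "read s (Reg ''h'') = int i" "i < length qs"
    and L: "qs ! i = L" "length L \<le> Suc k"
  shows "\<exists>s'. reaches (expand_prog dq V Q) s (200 * (k + 2)) s' \<and>
    building V Q k qs g (expand dq k g L a) s' \<and> read s' (Reg ''h'') = int (Suc i) \<and>
    read s' (Reg ''g'') = read s (Reg ''g'')"
proof -
  define s1 where "s1 = exec (fetch V Q) s"
  have r1: "reaches (fetch V Q) s 20 s1"
    unfolding s1_def by (rule reaches_weaken[OF reaches_exec]) (simp_all add: fetch_def)
  have b1: "building V Q k qs g a s1"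
    by (rule building_cong[OF b]) (auto simp: s1_def fetch_def)
  have q: "read s (Cell Q (int i)) = code L"
  proof -
    have "(qs @ fst a) ! i = L" "i < length (qs @ fst a)" using h L by (simp_all add: nth_append)
    then show ?thesis using b by (auto simp: building_def queue_def)
  qed
  have "read s (Cell V (4 * 4 ^ k + code L)) = int (g L)"
    using b L by (simp add: building_def layer_table_def)
  then have regs1: "read s1 (Reg ''c'') = code L" "read s1 (Reg ''u'') = code L"
    "read s1 (Reg ''v'') = int (g L)" "read s1 (Reg ''h'') = int (Suc i)" "read s1 (Reg ''g'') = read s (Reg ''g'')"
    using q h b by (simp_all add: s1_def fetch_def building_def)
  from push_loop_correct[OF b1 regs1(2,3) L(2)] obtain s2 a2 where
    r2: "reaches (push_loop V Q) s1 (60 * (Suc k - length L) + 4) s2"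
    and a2: "a2 = fold (tally (g L)) (map (\<lambda>e. replicate e Free @ L) [0..<Suc k - length L]) a"
    and b2: "building V Q k qs g a2 s2" by blast
  define s3 where "s3 = exec start_close s2"
  have r3: "reaches start_close s2 10 s3"
    unfolding s3_def by (rule reaches_weaken[OF reaches_exec]) (simp_all add: start_close_def)
  have b3: "building V Q k qs g a2 s3"
    by (rule building_cong[OF b2]) (auto simp: s3_def start_close_def)
  have same2: "read s2 (Reg y) = read s1 (Reg y)" if "y \<in> {''c'', ''v'', ''h'', ''g''}" for y
    using reaches_unchanged(2)[OF r2, of y] that by (auto simp: push_loop_def emit_def)
  have "\<exists>s4. reaches (close_loop dq V Q) s3 (120 * (length L - 0) + 4) s4 \<and>
    building V Q k qs g (fold (tally (g L)) (List.map_filter (\<lambda>d. close dq d L) [0..<length L]) a2) s4"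
    using regs1 same2 L(2) by (intro close_loop_correct[OF b3]) (simp_all add: s3_def start_close_def)
  then obtain s4 where r4: "reaches (close_loop dq V Q) s3 (120 * (length L - 0) + 4) s4"
    and b4: "building V Q k qs g (fold (tally (g L)) (List.map_filter (\<lambda>d. close dq d L) [0..<length L]) a2) s4"
    by blast
  have same4: "read s4 (Reg y) = read s1 (Reg y)" if "y \<in> {''h'', ''g''}" for y
    using reaches_unchanged(2)[OF r4, of y] same2[of y] that
    by (auto simp: close_loop_def close_emit_def close_advance_def emit_def s3_def start_close_def)
  have "expand dq k g L a = fold (tally (g L)) (List.map_filter (\<lambda>d. close dq d L) [0..<length L]) a2"
    by (simp add: expand_def successors_def a2)
  moreover have "reaches (expand_prog dq V Q) s (200 * (k + 2)) s4"
    unfolding expand_prog_def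
    by (rule reaches_weaken[OF reaches_Seq[OF r1 reaches_Seq[OF r2 reaches_Seq[OF r3 r4]]]]) (use L in simp)
  ultimately show ?thesis using b4 same4 regs1 by auto
qed

lemma layer_loop_correct:
  assumes "building V Q k (front @ todo) g a s" "read s (Reg ''h'') = int (length front)"
    "read s (Reg ''g'') = int (length (front @ todo))" "\<forall>L\<in>set todo. length L \<le> Suc k"
  shows "\<exists>s'. reaches (layer_loop dq V Q) s (length todo * (200 * (k + 2) + 4) + 4) s' \<and>
    building V Q k (front @ todo) g (fold (expand dq k g) todo a) s' \<and>
    read s' (Reg ''h'') = int (length (front @ todo))"
  using assms
proof (induction todo arbitrary: front a s)
  case Nil
  then have "\<not> bval (Less (Var ''h'') (Var ''g'')) s" by simp
  then have "reaches (layer_loop dq V Q) s 4 s"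
    unfolding layer_loop_def by (intro reaches_weaken[OF reaches_WhileFalse]) simp_all
  then show ?case using Nil by auto
next
  case (Cons L todo)
  from expand_prog_correct[OF Cons.prems(1,2), of L dq] Cons.prems(4) obtain s1
    where r1: "reaches (expand_prog dq V Q) s (200 * (k + 2)) s1"
      and b1: "building V Q k (front @ L # todo) g (expand dq k g L a) s1"
      and h1: "read s1 (Reg ''h'') = int (Suc (length front))"
      and g1: "read s1 (Reg ''g'') = read s (Reg ''g'')" by auto
  from Cons.IH[of "front @ [L]" "expand dq k g L a" s1] b1 h1 g1 Cons.prems(3,4) obtain s2
    where r2: "reaches (layer_loop dq V Q) s1 (length todo * (200 * (k + 2) + 4) + 4) s2"
      and b2: "building V Q k (front @ L # todo) g (fold (expand dq k g) todo (expand dq k g L a)) s2"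
      and h2: "read s2 (Reg ''h'') = int (length (front @ L # todo))" by auto
  have "bval (Less (Var ''h'') (Var ''g'')) s" using Cons.prems(2,3) by simp
  from reaches_WhileTrue[OF this r1 r2[unfolded layer_loop_def]]
  have "reaches (layer_loop dq V Q) s (length (L # todo) * (200 * (k + 2) + 4) + 4) s2"
    unfolding layer_loop_def by (rule reaches_weaken) simp
  then show ?case using b2 h2 by auto
qed

text \<open>The situation between two layers. As keys of layer \<open>k - 1\<close> lie below
  \<open>4 ^ k\<close>, \<open>fresh\<close> provides the empty table from which that layer
  starts.\<close>

definition frontier :: "nat \<Rightarrow> link list list \<Rightarrow> link list list \<times> (link list \<Rightarrow> nat) \<Rightarrow> state \<Rightarrow> bool" where
  "frontier k qs a s \<longleftrightarrow>
     read s (Reg ''m'') = 4 ^ k \<and> queue Q (qs @ fst a) s \<and> read s (Reg ''h'') = int (length qs) \<and>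
     layer_table V k (snd a) s \<and> fresh V (4 ^ k) s"

lemma layer_correct:
  assumes fr: "frontier (Suc k) qs (xs, g) s" and xs: "\<forall>L\<in>set xs. length L \<le> Suc k"
  shows "\<exists>s'. reaches (Seq layer_start (layer_loop dq V Q)) s (length xs * (200 * (k + 2) + 4) + 20) s' \<and>
    frontier k (qs @ xs) (fold (expand dq k g) xs ([], \<lambda>_. 0)) s'"
proof -
  define s1 where "s1 = exec layer_start s"
  have r1: "reaches layer_start s 16 s1"
    unfolding s1_def by (rule reaches_weaken[OF reaches_exec]) (simp_all add: layer_start_def)
  have none: "s1 (Cell V (4 ^ k + code L)) = None" if "length L \<le> k" for L
  proof -
    have "(0 :: int) < 4 ^ k" by simp
    then have "4 ^ k + code L < 4 ^ Suc k"
      using code_less[OF that] unfolding power_Suc by linarith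
    then show ?thesis using fr by (simp add: frontier_def fresh_def s1_def layer_start_def)
  qed
  then have zero: "read s1 (Cell V (4 ^ k + code L)) = 0" if "length L \<le> k" for L
    using that by (simp add: read_def)
  have "fresh V (4 ^ k) s1"
  proof -
    have "(4 :: int) ^ k \<le> 4 ^ Suc k" by simp
    then have "fresh V (4 ^ k) s" using fr unfolding frontier_def fresh_def by (meson less_le_trans)
    then show ?thesis by (simp add: fresh_def s1_def layer_start_def)
  qed
  then have b1: "building V Q k (qs @ xs) g ([], \<lambda>_. 0) s1"
    using fr none zero
    by (auto simp: building_def frontier_def queue_def layer_table_def s1_def layer_start_def)
  have "read s1 (Reg ''h'') = int (length qs)" "read s1 (Reg ''g'') = int (length (qs @ xs))"
    using fr by (simp_all add: frontier_def queue_def s1_def layer_start_def)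
  from layer_loop_correct[OF b1 this xs, of dq] obtain s2
    where r2: "reaches (layer_loop dq V Q) s1 (length xs * (200 * (k + 2) + 4) + 4) s2"
      and b2: "building V Q k (qs @ xs) g (fold (expand dq k g) xs ([], \<lambda>_. 0)) s2"
      and h2: "read s2 (Reg ''h'') = int (length (qs @ xs))" by blast
  have "reaches (Seq layer_start (layer_loop dq V Q)) s (length xs * (200 * (k + 2) + 4) + 20) s2"
    by (rule reaches_weaken[OF reaches_Seq[OF r1 r2]]) simp
  moreover have "frontier k (qs @ xs) (fold (expand dq k g) xs ([], \<lambda>_. 0)) s2"
    using b2 h2 by (simp add: frontier_def building_def)
  ultimately show ?thesis by blast
qed

text \<open>Each of the \<open>k\<close> layers has at most \<open>32 * 2 ^ n\<close> states by
  \<open>card_admissible\<close>, and each state costs at most \<open>200 * (n + 2) + 4\<close>; 24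
  covers the overhead of a layer.\<close>

lemma layers_prog_correct:
  assumes "frontier k qs a s" "table_ok a" "\<forall>L\<in>set (fst a). admissible n k L" "k \<le> n"
  shows "\<exists>s'. reaches (layers_prog dq V Q) s (k * (32 * 2 ^ n * (200 * (n + 2) + 4) + 24) + 4) s' \<and>
    read s' (Cell V 1) = int (weighted_total (ways dq k) a)"
  using assms
proof (induction k arbitrary: qs a s)
  case 0
  obtain xs g where a: "a = (xs, g)" by force
  from 0 have "\<not> bval (Less (Const 1) (Var ''m'')) s" by (simp add: frontier_def)
  then have r: "reaches (layers_prog dq V Q) s 4 s"
    unfolding layers_prog_def by (intro reaches_weaken[OF reaches_WhileFalse]) simp_all
  have "read s (Cell V (4 ^ 0 + code [])) = int (g [])"
    using 0 by (simp add: frontier_def layer_table_def a del: code.simps)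
  moreover have "weighted_total (ways dq 0) a = g []"
  proof -
    have "set xs \<subseteq> {[]}" using 0 by (auto simp: a admissible_def)
    then have "set xs = {} \<or> set xs = {[]}" by (rule subset_singletonD)
    then show ?thesis using 0 by (auto simp: weighted_total_def a table_ok_def)
  qed
  ultimately show ?case using r by (intro exI[of _ s]) (simp del: ways.simps)
next
  case (Suc k)
  obtain xs g where a: "a = (xs, g)" by force
  let ?a = "fold (expand dq k g) xs ([], \<lambda>_. 0)"
  have empty: "table_ok ([], \<lambda>_. 0)" by (simp add: table_ok_def)
  note props = fold_expand_properties[OF empty, of dq k g xs]
  have "\<forall>L\<in>set xs. length L \<le> Suc k" using Suc.prems(3) by (auto simp: a admissible_def)
  from layer_correct[OF Suc.prems(1)[unfolded a] this, of dq] obtain s1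
    where r1: "reaches (Seq layer_start (layer_loop dq V Q)) s (length xs * (200 * (k + 2) + 4) + 20) s1"
      and f1: "frontier k (qs @ xs) ?a s1" by blast
  have adm: "\<forall>L\<in>set (fst ?a). admissible n k L"
    using props(3) Suc.prems(3) admissible_successor by (auto simp: a)
  from Suc.IH[OF f1 props(1) adm] Suc.prems(4) obtain s2
    where r2: "reaches (layers_prog dq V Q) s1 (k * (32 * 2 ^ n * (200 * (n + 2) + 4) + 24) + 4) s2"
      and v: "read s2 (Cell V 1) = int (weighted_total (ways dq k) ?a)" by auto
  have xs: "distinct xs" using Suc.prems(2) by (simp add: a table_ok_def)
  have "weighted_total (ways dq k) ?a = (\<Sum>L\<leftarrow>xs. g L * ways dq (Suc k) L)"
    using props(2) by (simp add: weighted_total_def)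
  also have "\<dots> = weighted_total (ways dq (Suc k)) a"
    using xs by (simp only: sum_list_distinct_conv_sum_set weighted_total_def a prod.case)
  finally have v': "read s2 (Cell V 1) = int (weighted_total (ways dq (Suc k)) a)" using v by simp
  have "length xs = card (set xs)" using xs by (simp add: distinct_card)
  also have "\<dots> \<le> card {L. admissible n (Suc k) L}"
    using Suc.prems(3) card_admissible(1) by (intro card_mono) (auto simp: a)
  also have "\<dots> \<le> 32 * 2 ^ n" by (rule card_admissible(2))
  finally have len: "length xs * (200 * (k + 2) + 4) \<le> 32 * 2 ^ n * (200 * (n + 2) + 4)"
    using Suc.prems(4) by (intro mult_mono) auto
  have "1 < (4 :: int) ^ Suc k" by (rule one_less_power) auto
  then have "bval (Less (Const 1) (Var ''m'')) s" using Suc.prems(1) by (simp add: frontier_def)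
  from reaches_WhileTrue[OF this r1 r2[unfolded layers_prog_def]]
  have "reaches (layers_prog dq V Q) s (Suc k * (32 * 2 ^ n * (200 * (n + 2) + 4) + 24) + 4) s2"
    unfolding layers_prog_def by (rule reaches_weaken) (use len in simp)
  then show ?case using v' by blast
qed

lemma power_prog_correct:
  assumes "read s (Reg ''n'') = int n"
  shows "\<exists>s'. reaches power_prog s (20 * n + 10) s' \<and> read s' (Reg ''m'') = 4 ^ n"
proof -
  define body where "body = Seq (Assign ''m'' (Times (Const 4) (Var ''m''))) (Assign ''i'' (Plus (Var ''i'') (Const 1)))"
  define c where "c = While (Less (Var ''i'') (Var ''n'')) body"
  have loop: "\<exists>s'. reaches c s (20 * j + 4) s' \<and> read s' (Reg ''m'') = 4 ^ n"
    if "read s (Reg ''n'') = int n" "read s (Reg ''i'') = int (n - j)" "read s (Reg ''m'') = 4 ^ (n - j)"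
      "j \<le> n" for j s
    using that
  proof (induction j arbitrary: s)
    case 0
    then have "\<not> bval (Less (Var ''i'') (Var ''n'')) s" by simp
    then have "reaches c s 4 s"
      unfolding c_def by (intro reaches_weaken[OF reaches_WhileFalse]) simp_all
    then show ?case using 0 by auto
  next
    case (Suc j)
    define s1 where "s1 = exec body s"
    have r1: "reaches body s 10 s1"
      unfolding s1_def by (rule reaches_weaken[OF reaches_exec]) (simp_all add: body_def)
    have regs: "read s1 (Reg ''n'') = read s (Reg ''n'')" "read s1 (Reg ''m'') = 4 * read s (Reg ''m'')"
      "read s1 (Reg ''i'') = read s (Reg ''i'') + 1"
      by (simp_all add: s1_def body_def)
    have "n - j = Suc (n - Suc j)" using Suc.prems(4) by simp
    then have "\<exists>s'. reaches c s1 (20 * j + 4) s' \<and> read s' (Reg ''m'') = 4 ^ n"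
      using Suc.prems regs by (intro Suc.IH) simp_all
    then obtain s2 where r2: "reaches c s1 (20 * j + 4) s2" and m: "read s2 (Reg ''m'') = 4 ^ n" by blast
    have "bval (Less (Var ''i'') (Var ''n'')) s" using Suc.prems by simp
    from reaches_WhileTrue[OF this r1 r2[unfolded c_def]]
    have "reaches c s (20 * Suc j + 4) s2" unfolding c_def by (rule reaches_weaken) simp
    then show ?case using m by blast
  qed
  define s0 where "s0 = exec (Seq (Assign ''m'' (Const 1)) (Assign ''i'' (Const 0))) s"
  have r0: "reaches (Seq (Assign ''m'' (Const 1)) (Assign ''i'' (Const 0))) s 6 s0"
    unfolding s0_def by (rule reaches_weaken[OF reaches_exec]) simp_all
  have "\<exists>s'. reaches c s0 (20 * n + 4) s' \<and> read s' (Reg ''m'') = 4 ^ n"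
    using assms by (intro loop) (simp_all add: s0_def)
  then obtain s' where r: "reaches c s0 (20 * n + 4) s'" and m: "read s' (Reg ''m'') = 4 ^ n" by blast
  have "reaches power_prog s (20 * n + 10) s'"
    unfolding power_prog_def
    by (rule reaches_weaken[OF reaches_Seq[OF r0 r[unfolded c_def body_def]]]) simp
  then show ?thesis using m by blast
qed

lemma count_prog_correct:
  assumes n: "read s (Reg ''n'') = int n" and V: "\<And>j. s (Cell V j) = None"
  shows "\<exists>s'. reaches (count_prog dq V Q r) s (n * (32 * 2 ^ n * (200 * (n + 2) + 4) + 44) + 40) s' \<and>
    s' (Reg r) = Some (int (ways dq n []))"
proof -
  from power_prog_correct[OF n] obtain s1
    where r1: "reaches power_prog s (20 * n + 10) s1" and m: "read s1 (Reg ''m'') = 4 ^ n" by blast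
  have V1: "s1 (Cell V j) = None" for j
    using reaches_unchanged(3)[OF r1, of V j] V by (simp add: power_prog_def)
  then have rV1: "read s1 (Cell V j) = 0" for j by (simp add: read_def)
  let ?g = "\<lambda>L :: link list. if L = [] then 1 else 0 :: nat"
  define s2 where "s2 = exec (count_init V Q) s1"
  have r2: "reaches (count_init V Q) s1 20 s2"
    unfolding s2_def by (rule reaches_weaken[OF reaches_exec]) (simp_all add: count_init_def)
  have "code L = 0 \<longleftrightarrow> L = []" for L
    using code_eq_iff[of L "[]"] by (simp del: code_eq_iff)
  then have "frontier n [] ([[]], ?g) s2"
    using VQ V1 rV1 m
    by (auto simp: frontier_def s2_def count_init_def queue_def layer_table_def fresh_def)
  moreover have "table_ok ([[]], ?g)" by (simp add: table_ok_def)
  moreover have "\<forall>L\<in>set (fst ([[]], ?g)). admissible n n L" by (simp add: admissible_def)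
  ultimately obtain s3 where
    r3: "reaches (layers_prog dq V Q) s2 (n * (32 * 2 ^ n * (200 * (n + 2) + 4) + 24) + 4) s3"
    and v: "read s3 (Cell V 1) = int (weighted_total (ways dq n) ([[]], ?g))"
    using layers_prog_correct by blast
  \<comment> \<open>The key 1 is \<open>4 ^ 0 + code []\<close>, the only state in layer 0.\<close>
  let ?r = "Assign r (Lookup V (Const 1))"
  have r4: "reaches ?r s3 4 (exec ?r s3)"
    by (rule reaches_weaken[OF reaches_exec]) simp_all
  have "reaches (count_prog dq V Q r) s (n * (32 * 2 ^ n * (200 * (n + 2) + 4) + 44) + 40) (exec ?r s3)"
    unfolding count_prog_def
    by (rule reaches_weaken[OF reaches_Seq[OF r1 reaches_Seq[OF r2 reaches_Seq[OF r3 r4]]]])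
      (simp add: algebra_simps)
  moreover have "exec ?r s3 (Reg r) = Some (int (ways dq n []))"
    using v by (simp add: weighted_total_def)
  ultimately show ?thesis by blast
qed

end

theorem theorem8p4:
  "\<exists>(prog :: com) (time :: nat \<Rightarrow> nat) (space :: nat \<Rightarrow> nat).
     (\<forall>n\<ge>1. \<exists>s. run prog (input_state n) (time n) (space n) s \<and>
        s (Reg ''C'') = Some (int (card (stacks_sortable_perms n))) \<and>
        s (Reg ''D'') = Some (int (card (deque_sortable_perms n)))) \<and>
     (\<lambda>n. real (time n)) \<in> O(\<lambda>n. real n ^ 5 * 2 ^ n) \<and>
     (\<lambda>n. real (space n)) \<in> O(\<lambda>n. real n ^ 2 * 2 ^ n)"
proof -
  \<comment> \<open>The two runs get different dictionaries because the second must also find its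
    table empty; the working registers are shared and reinitialised.\<close>
  let ?c = "count_prog False ''VC'' ''QC'' ''C''"
  let ?d = "count_prog True ''VD'' ''QD'' ''D''"
  let ?T = "\<lambda>n. n * (32 * 2 ^ n * (200 * (n + 2) + 4) + 44) + 40 :: nat"
  have T: "2 * ?T n + 1 \<le> 40000 * (n ^ 2 * 2 ^ n)" if "1 \<le> n" for n
  proof -
    define p where "p = (2 :: nat) ^ n"
    have p: "1 \<le> p" by (simp add: p_def)
    \<comment> \<open>For \<open>n \<ge> 1\<close> every term is bounded by a multiple of
      \<open>n ^ 2 * p\<close>, and the factors add up to \<open>32 * 604 + 44 + 40 = 19412\<close>.
      Two runs and the input location stay below 40000.\<close>
    have "n * (32 * p * (200 * (n + 2) + 4) + 44) + 40 \<le>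
      n * (32 * p * (604 * n) + 44 * (n * p)) + 40 * (n * (n * p))"
    proof -
      have "200 * (n + 2) + 4 \<le> 604 * n" using that by simp
      moreover have "1 \<le> n * p" using that p by simp
      moreover have "1 \<le> n * (n * p)" using that p by simp
      ultimately show ?thesis
        by (intro add_mono mult_le_mono2) simp_all
    qed
    also have "\<dots> = 19412 * (n ^ 2 * p)" by (simp add: power2_eq_square algebra_simps)
    finally have *: "n * (32 * p * (200 * (n + 2) + 4) + 44) + 40 \<le> 19412 * (n ^ 2 * p)" .
    moreover have "1 \<le> n ^ 2 * p" using that p by simp
    moreover have "2 * a + 1 \<le> 40000 * b" if "a \<le> 19412 * b" "1 \<le> b" for a b :: nat
      using that by simp
    ultimately show ?thesis unfolding p_def by blast
  qed
  have main: "\<exists>t m s. run (Seq ?c ?d) (input_state n) t m s \<and>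
      s (Reg ''C'') = Some (int (card (stacks_sortable_perms n))) \<and>
      s (Reg ''D'') = Some (int (card (deque_sortable_perms n))) \<and>
      t \<le> 2 * ?T n \<and> m \<le> 2 * ?T n + 1" for n
  proof -
    have "read (input_state n) (Reg ''n'') = int n" by (simp add: input_state_def read_def)
    moreover have "input_state n (Cell d j) = None" for d j by (simp add: input_state_def)
    ultimately obtain s1 where r1: "reaches ?c (input_state n) (?T n) s1"
      and C1: "s1 (Reg ''C'') = Some (int (ways False n []))"
      using count_prog_correct[of "''VC''" "''QC''" "input_state n" n False "''C''"] by auto
    have "read s1 (Reg ''n'') = int n"
      using reaches_unchanged(2)[OF r1, of "''n''"]
      by (simp add: prog_defs input_state_def read_def)
    moreover have "s1 (Cell ''VD'' j) = None" for j
      using reaches_unchanged(3)[OF r1, of "''VD''" j] by (simp add: prog_defs input_state_def)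
    ultimately obtain s2 where r2: "reaches ?d s1 (?T n) s2"
      and D2: "s2 (Reg ''D'') = Some (int (ways True n []))"
      using count_prog_correct[of "''VD''" "''QD''" s1 n True "''D''"] by auto
    have C2: "s2 (Reg ''C'') = Some (int (ways False n []))"
      using reaches_unchanged(1)[OF r2, of "''C''"] C1 by (simp add: prog_defs)
    from reaches_Seq[OF r1 r2] obtain t m where r: "run (Seq ?c ?d) (input_state n) t m s2" "t \<le> 2 * ?T n"
      unfolding reaches_def by auto
    moreover have "usage (input_state n) = 1" by (simp add: usage_def input_state_def)
    ultimately have "m \<le> 2 * ?T n + 1" using run_space_le[OF r(1)] by simp
    then show ?thesis using r C2 D2 by (auto simp: card_sortable_perms)
  qed
  obtain time space final where
    run: "\<And>n. run (Seq ?c ?d) (input_state n) (time n) (space n) (final n)"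
    and res: "\<And>n. final n (Reg ''C'') = Some (int (card (stacks_sortable_perms n)))"
      "\<And>n. final n (Reg ''D'') = Some (int (card (deque_sortable_perms n)))"
    and bounds: "\<And>n. time n \<le> 2 * ?T n" "\<And>n. space n \<le> 2 * ?T n + 1"
    using main by metis
  have "(\<lambda>n. real (time n)) \<in> O(\<lambda>n. real n ^ 5 * 2 ^ n)"
  proof (rule bigoI[where c = 40000], rule eventually_sequentiallyI[of 1])
    fix n :: nat assume n: "1 \<le> n"
    have "time n \<le> 40000 * (n ^ 2 * 2 ^ n)" using bounds(1)[of n] T[OF n] by linarith
    also have "\<dots> \<le> 40000 * (n ^ 5 * 2 ^ n)"
      using n by (intro mult_le_mono mult_le_mono1 power_increasing) auto
    finally have "real (time n) \<le> real (40000 * (n ^ 5 * 2 ^ n))" by (simp only: of_nat_le_iff)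
    then show "norm (real (time n)) \<le> 40000 * norm (real n ^ 5 * 2 ^ n)" by simp
  qed
  moreover have "(\<lambda>n. real (space n)) \<in> O(\<lambda>n. real n ^ 2 * 2 ^ n)"
  proof (rule bigoI[where c = 40000], rule eventually_sequentiallyI[of 1])
    fix n :: nat assume n: "1 \<le> n"
    have "space n \<le> 40000 * (n ^ 2 * 2 ^ n)" using bounds(2)[of n] T[OF n] by linarith
    then have "real (space n) \<le> real (40000 * (n ^ 2 * 2 ^ n))" by (simp only: of_nat_le_iff)
    then show "norm (real (space n)) \<le> 40000 * norm (real n ^ 2 * 2 ^ n)" by simp
  qed
  ultimately show ?thesis using run res by blast
qed

end
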